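(* Let $E$ be a locally complete lcHs over $\mathbb{K}$, let the linear subspace $G\subset E'$ determine boundedness, $\Omega\subset\mathbb{R}^{d}$ open, $k\in\mathbb{N}_{0}$ and $0<\gamma\leq 1$. a) If $f\colon\Omega\to E$ is such that $e'\circ f\in\mathcal{C}^{k,\gamma}_{loc}(\Omega)$ for all $e'\in G$, then $f\in\mathcal{C}^{k,\gamma}_{loc}(\Omega,E)$. b) If $f\colon\Omega\to E$ is such that $e'\circ f\in\mathcal{C}^{k+1}(\Omega)$ for all $e'\in G$, then $f\in\mathcal{C}^{k,1}_{loc}(\Omega,E)$.
   Context: $\mathbb{K}=\mathbb{R}$ or $\mathbb{C}$. An lcHs is a non-trivial locally convex Hausdorff space over $\mathbb{K}$; the topology of $E$ is given by a directed system of seminorms $(p_\alpha)_{\alpha\in\mathfrak{A}}$. $E$ is locally complete if for every closed bounded absolutely convex $D\subset E$ the space $E_D:=\bigcup_n nD$, normed by the gauge of $D$, is a Banach space. $G\subset E'$ determines boundedness if every $\sigma(E,G)$-bounded subset of $E$ is bounded in $E$. $\mathcal{C}^{k}(\Omega,E)$ is the space of $k$-times continuously partially differentiable functions $f\colon\Omega\to E$ (partial derivatives $(\partial^{\beta})^{E}f$ being iterated limits in $E$ of difference quotients, all continuous for $|\beta|\le k$); for $k=0$ it is the space of continuous functions. $\mathcal{C}^{k,\gamma}_{loc}(\Omega,E)$ is the space of $f\in\mathcal{C}^{k}(\Omega,E)$ such that for every compact $K\subset\Omega$, $\alpha\in\mathfrak{A}$ and $\beta\in\mathbb{N}_0^{d}$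 with $|\beta|=k$, \[ \sup_{x,y\in K,\,x\neq y}\frac{p_\alpha((\partial^{\beta})^{E}f(x)-(\partial^{\beta})^{E}f(y))}{|x-y|^{\gamma}}<\infty \] (the suprema of $p_\alpha((\partial^\beta)^Ef)$ over $K$ for $|\beta|\le k$ being also finite). For $E=\mathbb{K}$ one writes $\mathcal{C}^{k}(\Omega)$, $\mathcal{C}^{k,\gamma}_{loc}(\Omega)$. *)

theory Defs
  imports "HOL-Analysis.Analysis"
begin

text \<open>
  The scalar field is a type of class \<open>real_normed_field\<close>. By the Gelfand-Mazur theorem every
  such field is isometrically isomorphic to \<open>real\<close> or \<open>complex\<close>, and both types are instances,
  so the class renders ``the real or the complex numbers''. The scalar multiplication of the
  vector space is an explicit parameter, because the type classes of HOL only provide real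
  scalars. Taking \<open>smul = (*)\<close> and \<open>P = {norm}\<close> gives the scalar field itself.
\<close>

section \<open>Locally convex Hausdorff spaces\<close>

definition seminorm :: "('k::real_normed_field \<Rightarrow> 'e::ab_group_add \<Rightarrow> 'e) \<Rightarrow> ('e \<Rightarrow> real) \<Rightarrow> bool"
  where "seminorm smul p \<longleftrightarrow>
    (\<forall>x. 0 \<le> p x) \<and> (\<forall>c x. p (smul c x) = norm c * p x) \<and> (\<forall>x y. p (x + y) \<le> p x + p y)"

definition directed_seminorms :: "('e \<Rightarrow> real) set \<Rightarrow> bool"
  where "directed_seminorms P \<longleftrightarrow>
    (\<forall>p\<in>P. \<forall>q\<in>P. \<exists>r\<in>P. \<exists>C. \<forall>x. max (p x) (q x) \<le> C * r x)"

text \<open>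
  The Hausdorff property is part of the class \<open>t2_space\<close>. The set \<open>P\<close> is nonempty, since
  otherwise \<open>UNIV\<close> would not be open.
\<close>

definition lcHs :: "('k::real_normed_field \<Rightarrow> 'e::{ab_group_add,t2_space} \<Rightarrow> 'e) \<Rightarrow>
    ('e \<Rightarrow> real) set \<Rightarrow> bool"
  where "lcHs smul P \<longleftrightarrow>
    vector_space smul \<and>
    (\<exists>x::'e. x \<noteq> 0) \<and>
    (\<forall>p\<in>P. seminorm smul p) \<and>
    directed_seminorms P \<and>
    (\<forall>U. open U \<longleftrightarrow> (\<forall>x\<in>U. \<exists>p\<in>P. \<exists>\<epsilon>>0. {y. p (y - x) < \<epsilon>} \<subseteq> U))"

definition bounded_wrt :: "('e \<Rightarrow> real) set \<Rightarrow> 'e set \<Rightarrow> bool"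
  where "bounded_wrt P B \<longleftrightarrow> (\<forall>p\<in>P. bdd_above (p ` B))"


section \<open>Local completeness\<close>

definition absolutely_convex :: "('k::real_normed_field \<Rightarrow> 'e::ab_group_add \<Rightarrow> 'e) \<Rightarrow> 'e set \<Rightarrow> bool"
  where "absolutely_convex smul D \<longleftrightarrow> D \<noteq> {} \<and>
    (\<forall>x\<in>D. \<forall>y\<in>D. \<forall>a b. norm a + norm b \<le> 1 \<longrightarrow> smul a x + smul b y \<in> D)"

definition disc_span :: "('k::real_normed_field \<Rightarrow> 'e \<Rightarrow> 'e) \<Rightarrow> 'e set \<Rightarrow> 'e set"
  where "disc_span smul D = (\<Union>n::nat. smul (of_nat n) ` D)"

definition disc_gauge :: "('k::real_normed_field \<Rightarrow> 'e \<Rightarrow> 'e) \<Rightarrow> 'e set \<Rightarrow> 'e \<Rightarrow> real"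
  where "disc_gauge smul D x = Inf {t. 0 < t \<and> x \<in> smul (of_real t) ` D}"

definition banach_space_on :: "('k::real_normed_field \<Rightarrow> 'e::ab_group_add \<Rightarrow> 'e) \<Rightarrow> 'e set \<Rightarrow>
    ('e \<Rightarrow> real) \<Rightarrow> bool"
  where "banach_space_on smul V N \<longleftrightarrow>
    module.subspace smul V \<and>
    (\<forall>x\<in>V. 0 \<le> N x \<and> (N x = 0 \<longleftrightarrow> x = 0)) \<and>
    (\<forall>c. \<forall>x\<in>V. N (smul c x) = norm c * N x) \<and>
    (\<forall>x\<in>V. \<forall>y\<in>V. N (x + y) \<le> N x + N y) \<and>
    (\<forall>X :: nat \<Rightarrow> 'e. range X \<subseteq> V \<longrightarrow>
      (\<forall>\<epsilon>>0. \<exists>M. \<forall>m\<ge>M. \<forall>n\<ge>M. N (X m - X n) < \<epsilon>) \<longrightarrow>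
      (\<exists>x\<in>V. (\<lambda>n. N (X n - x)) \<longlonglongrightarrow> 0))"

definition locally_complete :: "('k::real_normed_field \<Rightarrow> 'e::{ab_group_add,t2_space} \<Rightarrow> 'e) \<Rightarrow>
    ('e \<Rightarrow> real) set \<Rightarrow> bool"
  where "locally_complete smul P \<longleftrightarrow>
    (\<forall>D. closed D \<longrightarrow> bounded_wrt P D \<longrightarrow> absolutely_convex smul D \<longrightarrow>
      banach_space_on smul (disc_span smul D) (disc_gauge smul D))"


section \<open>The dual space\<close>

definition dual_space :: "('k::real_normed_field \<Rightarrow> 'e::{ab_group_add,t2_space} \<Rightarrow> 'e) \<Rightarrow>
    ('e \<Rightarrow> 'k) set"
  where "dual_space smul = {\<phi>. Vector_Spaces.linear smul (*) \<phi> \<and> continuous_on UNIV \<phi>}"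

definition dual_subspace :: "('k::real_normed_field \<Rightarrow> 'e::{ab_group_add,t2_space} \<Rightarrow> 'e) \<Rightarrow>
    ('e \<Rightarrow> 'k) set \<Rightarrow> bool"
  where "dual_subspace smul G \<longleftrightarrow> G \<subseteq> dual_space smul \<and> (\<lambda>x. 0) \<in> G \<and>
    (\<forall>\<phi>\<in>G. \<forall>\<psi>\<in>G. (\<lambda>x. \<phi> x + \<psi> x) \<in> G) \<and> (\<forall>c. \<forall>\<phi>\<in>G. (\<lambda>x. c * \<phi> x) \<in> G)"

text \<open>The topology \<open>\<sigma>(E, G)\<close> is generated by the seminorms \<open>x \<mapsto> \<bar>\<phi> x\<bar>\<close> with \<open>\<phi> \<in> G\<close>.\<close>

definition weak_seminorms :: "('e \<Rightarrow> 'k::real_normed_field) set \<Rightarrow> ('e \<Rightarrow> real) set"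
  where "weak_seminorms G = (\<lambda>\<phi> x. norm (\<phi> x)) ` G"

definition determines_boundedness :: "('e \<Rightarrow> real) set \<Rightarrow> ('e \<Rightarrow> 'k::real_normed_field) set \<Rightarrow> bool"
  where "determines_boundedness P G \<longleftrightarrow>
    (\<forall>B. bounded_wrt (weak_seminorms G) B \<longrightarrow> bounded_wrt P B)"


section \<open>Spaces of differentiable functions\<close>

text \<open>
  Functions on an open set \<open>\<Omega>\<close> are represented by total functions. At a point of \<open>\<Omega>\<close> the partial
  derivatives only depend on the restriction to \<open>\<Omega>\<close>, so the values outside \<open>\<Omega>\<close> are irrelevant
  to all the notions below.
\<close>

definition diff_quot :: "('k::real_normed_field \<Rightarrow> 'e::{ab_group_add,t2_space} \<Rightarrow> 'e) \<Rightarrow> 'd::finite \<Rightarrow>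
    (real^'d \<Rightarrow> 'e) \<Rightarrow> real^'d \<Rightarrow> real \<Rightarrow> 'e"
  where "diff_quot smul i f x h = smul (of_real (1 / h)) (f (x + h *\<^sub>R axis i 1) - f x)"

definition has_partial_deriv :: "('k::real_normed_field \<Rightarrow> 'e::{ab_group_add,t2_space} \<Rightarrow> 'e) \<Rightarrow>
    'd::finite \<Rightarrow> (real^'d \<Rightarrow> 'e) \<Rightarrow> real^'d \<Rightarrow> bool"
  where "has_partial_deriv smul i f x \<longleftrightarrow> (\<exists>l. (diff_quot smul i f x \<longlongrightarrow> l) (at 0))"

definition partial_deriv :: "('k::real_normed_field \<Rightarrow> 'e::{ab_group_add,t2_space} \<Rightarrow> 'e) \<Rightarrow>
    'd::finite \<Rightarrow> (real^'d \<Rightarrow> 'e) \<Rightarrow> real^'d \<Rightarrow> 'e"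
  where "partial_deriv smul i f x = Lim (at 0) (diff_quot smul i f x)"

text \<open>
  Multi-indices are functions \<open>\<beta> :: 'd \<Rightarrow> nat\<close>, and \<open>\<partial>\<^sup>\<beta> f = \<partial>\<^sub>1\<^bsup>\<beta>\<^sub>1\<^esup> (\<dots> (\<partial>\<^sub>d\<^bsup>\<beta>\<^sub>d\<^esup> f))\<close>, where the
  linear order on the index type fixes the order of the coordinates.
\<close>

definition multi_deriv :: "('k::real_normed_field \<Rightarrow> 'e::{ab_group_add,t2_space} \<Rightarrow> 'e) \<Rightarrow>
    ('d::{finite,linorder} \<Rightarrow> nat) \<Rightarrow> ((real, 'd) vec \<Rightarrow> 'e) \<Rightarrow> (real, 'd) vec \<Rightarrow> 'e"
  where "multi_deriv smul \<beta> f =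
    foldr (\<lambda>i. partial_deriv smul i ^^ \<beta> i) (sorted_list_of_set UNIV) f"

text \<open>All iterated partial derivatives of order at most \<open>k\<close>, in any order, exist on \<open>\<Omega>\<close> and are
  continuous there.\<close>

fun cont_partially_diff :: "('k::real_normed_field \<Rightarrow> 'e::{ab_group_add,t2_space} \<Rightarrow> 'e) \<Rightarrow> nat \<Rightarrow>
    (real^'d::finite) set \<Rightarrow> (real^'d \<Rightarrow> 'e) \<Rightarrow> bool"
  where
    "cont_partially_diff smul 0 \<Omega> f \<longleftrightarrow> continuous_on \<Omega> f"
  | "cont_partially_diff smul (Suc k) \<Omega> f \<longleftrightarrow> continuous_on \<Omega> f \<and>
      (\<forall>i. (\<forall>x\<in>\<Omega>. has_partial_deriv smul i f x) \<and>
           cont_partially_diff smul k \<Omega> (partial_deriv smul i f))"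

definition C_space :: "('k::real_normed_field \<Rightarrow> 'e::{ab_group_add,t2_space} \<Rightarrow> 'e) \<Rightarrow> nat \<Rightarrow>
    (real^'d::finite) set \<Rightarrow> (real^'d \<Rightarrow> 'e) set"
  where "C_space smul k \<Omega> = {f. cont_partially_diff smul k \<Omega> f}"

definition C_loc_space :: "('k::real_normed_field \<Rightarrow> 'e::{ab_group_add,t2_space} \<Rightarrow> 'e) \<Rightarrow>
    ('e \<Rightarrow> real) set \<Rightarrow> nat \<Rightarrow> real \<Rightarrow> (real^'d::{finite,linorder}) set \<Rightarrow> ((real, 'd) vec \<Rightarrow> 'e) set"
  where "C_loc_space smul P k \<gamma> \<Omega> = {f \<in> C_space smul k \<Omega>. \<forall>K p. compact K \<longrightarrow> K \<subseteq> \<Omega> \<longrightarrow> p \<in> P \<longrightarrow>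
    (\<forall>\<beta>. (\<Sum>i\<in>UNIV. \<beta> i) \<le> k \<longrightarrow> bdd_above ((\<lambda>x. p (multi_deriv smul \<beta> f x)) ` K)) \<and>
    (\<forall>\<beta>. (\<Sum>i\<in>UNIV. \<beta> i) = k \<longrightarrow>
      bdd_above {p (multi_deriv smul \<beta> f x - multi_deriv smul \<beta> f y) / norm (x - y) powr \<gamma> | x y.
        x \<in> K \<and> y \<in> K \<and> x \<noteq> y})}"

end

theory Submission
  imports Defs
begin

text \<open>
  Since \<open>G\<close> determines boundedness, an estimate \<open>\<bar>\<phi> b\<bar> \<le> C\<^sub>\<phi>\<close> for \<open>b\<close> in a fixed set and
  all \<open>\<phi> \<in> G\<close> can be lifted to all seminorms of \<open>E\<close>. Applied to the quotients
  \<open>(f x - f y) / \<bar>x - y\<bar>\<^sup>\<gamma>\<close>, this lifts local Hoelder continuity. If \<open>\<partial>\<^sub>i (\<phi> \<circ> f)\<close> is locally Hoelder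
  continuous for all \<open>\<phi> \<in> G\<close>, the mean value inequality shows that the difference quotients
  \<open>d\<^sub>h\<close> of \<open>f\<close> are such that \<open>(d\<^sub>h - d\<^sub>h\<^sub>') / (\<bar>h\<bar>\<^sup>\<gamma> + \<bar>h'\<bar>\<^sup>\<gamma>)\<close> is bounded in \<open>E\<close>, hence contained
  in a closed disc, and local completeness yields the existence of \<open>\<partial>\<^sub>i f\<close>. Iterating over the
  partial derivatives proves part a); part b) follows because scalar functions in \<open>C\<^bsup>k+1\<^esup>\<close>
  have locally Lipschitz derivatives of order \<open>k\<close>. Schwarz's theorem for scalar functions
  transfers the Hoelder condition from the sorted multi-indices of the definition to
  derivatives taken in any order.
\<close>

section \<open>Locality of partial derivatives, and iterated derivatives\<close>

section \<open>Partial derivatives\<close>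

lemma partial_deriv_unique:
  assumes "(diff_quot smul i f x \<longlongrightarrow> l) (at 0)"
  shows "partial_deriv smul i f x = l"
  unfolding partial_deriv_def using assms by (intro tendsto_Lim) auto

lemma has_partial_deriv_tendsto:
  assumes "has_partial_deriv smul i f x"
  shows "(diff_quot smul i f x \<longlongrightarrow> partial_deriv smul i f x) (at 0)"
  using assms partial_deriv_unique unfolding has_partial_deriv_def by metis

lemma eventually_axis_shift:
  fixes \<Omega> :: "(real^'d::finite) set"
  assumes "open \<Omega>" "x \<in> \<Omega>"
  shows "\<forall>\<^sub>F h in at 0. x + h *\<^sub>R axis i 1 \<in> \<Omega>"
proof -
  have "((\<lambda>h. x + h *\<^sub>R axis i (1::real)) \<longlongrightarrow> x + 0 *\<^sub>R axis i 1) (at 0)"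
    by (intro tendsto_intros)
  then show ?thesis
    using assms topological_tendstoD by fastforce
qed

lemma diff_quot_tendsto_cong:
  assumes "open \<Omega>" "x \<in> \<Omega>" "\<And>y. y \<in> \<Omega> \<Longrightarrow> f y = g y"
  shows "(diff_quot smul i f x \<longlongrightarrow> l) (at 0) \<longleftrightarrow> (diff_quot smul i g x \<longlongrightarrow> l) (at 0)"
proof (rule tendsto_cong)
  show "\<forall>\<^sub>F h in at 0. diff_quot smul i f x h = diff_quot smul i g x h"
    using eventually_axis_shift[OF assms(1,2), of i]
    by eventually_elim (simp add: diff_quot_def assms)
qed

lemma has_partial_deriv_cong:
  assumes "open \<Omega>" "x \<in> \<Omega>" "\<And>y. y \<in> \<Omega> \<Longrightarrow> f y = g y"
  shows "has_partial_deriv smul i f x \<longleftrightarrow> has_partial_deriv smul i g x"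
  unfolding has_partial_deriv_def by (simp add: diff_quot_tendsto_cong[OF assms(1,2), of f g] assms(3))

text \<open>\<open>Lim\<close> is a definite description, and for small \<open>h\<close> the
  difference quotients evaluate their functions only inside \<Omega>. The two limit predicates
  coincide, so the equality also covers points where no limit exists.\<close>

lemma partial_deriv_cong:
  assumes "open \<Omega>" "x \<in> \<Omega>" "\<And>y. y \<in> \<Omega> \<Longrightarrow> f y = g y"
  shows "partial_deriv smul i f x = partial_deriv smul i g x"
  unfolding partial_deriv_def t2_space_class.Lim_def
  by (simp add: diff_quot_tendsto_cong[OF assms(1,2), of f g] assms(3))

text \<open>The recursion of \<open>cont_partially_diff\<close> strips off the derivative taken
  first, which in \<open>foldr\<close> belongs to the last list entry; hence the induction from the
  end of the list.\<close>

lemma cont_partially_diff_iterate: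
  assumes "cont_partially_diff smul k \<Omega> f" "length is \<le> k"
  shows "cont_partially_diff smul (k - length is) \<Omega> (foldr (partial_deriv smul) is f)"
  using assms
proof (induction "is" arbitrary: k f rule: rev_induct)
  case (snoc i "is")
  then obtain k' where k: "k = Suc k'"
    by (cases k) auto
  show ?case
    using snoc.IH[of k' "partial_deriv smul i f"] snoc.prems by (simp add: k)
qed simp

lemma cont_partially_diff_continuous:
  "cont_partially_diff smul k \<Omega> f \<Longrightarrow> continuous_on \<Omega> f"
  by (cases k) auto


section \<open>Mean value inequality, Schwarz's theorem and reordering of scalar derivatives\<close>

section \<open>Scalar functions\<close>

text \<open>Restriction to a coordinate line yields a function of one real variable, to which the
  mean value inequality applies.\<close>

lemma axis_has_vector_derivative:
  fixes f :: "real^'d::finite \<Rightarrow> 'k::real_normed_field"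
  assumes "has_partial_deriv (*) i f (x + t *\<^sub>R axis i 1)"
  shows "((\<lambda>s. f (x + s *\<^sub>R axis i 1)) has_vector_derivative
           partial_deriv (*) i f (x + t *\<^sub>R axis i 1)) (at t within S)"
proof -
  define l where "l = partial_deriv (*) i f (x + t *\<^sub>R axis i 1)"
  have 1: "((\<lambda>h. diff_quot (*) i f (x + t *\<^sub>R axis i 1) h - l) \<longlongrightarrow> 0) (at 0)"
    using has_partial_deriv_tendsto[OF assms] by (simp add: LIM_zero_iff l_def)
  have 2: "norm (f (x + (t + h) *\<^sub>R axis i 1) - f (x + t *\<^sub>R axis i 1) - h *\<^sub>R l) / norm h
      = norm (diff_quot (*) i f (x + t *\<^sub>R axis i 1) h - l)" if "h \<noteq> 0" for h
  proof -
    have "diff_quot (*) i f (x + t *\<^sub>R axis i 1) h - l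
      = (1 / h) *\<^sub>R (f (x + (t + h) *\<^sub>R axis i 1) - f (x + t *\<^sub>R axis i 1) - h *\<^sub>R l)"
      using that
      by (simp add: diff_quot_def scaleR_conv_of_real[where 'a='k] algebra_simps scaleR_add_left
          flip: of_real_mult)
    then show ?thesis by (simp add: divide_simps)
  qed
  have "((\<lambda>h. norm (f (x + (t + h) *\<^sub>R axis i 1) - f (x + t *\<^sub>R axis i 1) - h *\<^sub>R l) / norm h)
      \<longlongrightarrow> 0) (at 0)"
    using tendsto_norm_zero[OF 1]
    by (rule Lim_transform_eventually) (auto simp del: real_norm_def simp: eventually_at_filter 2)
  then have "((\<lambda>s. f (x + s *\<^sub>R axis i 1)) has_derivative (\<lambda>h. h *\<^sub>R l)) (at t)"
    unfolding has_derivative_at by (auto intro: bounded_linear_scaleR_left)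
  then show ?thesis
    by (simp add: has_vector_derivative_def l_def has_derivative_at_withinI)
qed

text \<open>The free constant \<open>c\<close> serves three uses: second differences, Lipschitz
  bounds with \<open>c = 0\<close>, and the rate of convergence of difference quotients.\<close>

lemma axis_mean_value:
  fixes f :: "real^'d::finite \<Rightarrow> 'k::real_normed_field"
  assumes "\<And>s. s \<in> closed_segment 0 t \<Longrightarrow> has_partial_deriv (*) i f (x + s *\<^sub>R axis i 1)"
    and "\<And>s. s \<in> closed_segment 0 t \<Longrightarrow> norm (partial_deriv (*) i f (x + s *\<^sub>R axis i 1) - c) \<le> B"
  shows "norm (f (x + t *\<^sub>R axis i 1) - f x - t *\<^sub>R c) \<le> B * \<bar>t\<bar>"
proof -
  define u where "u s = f (x + s *\<^sub>R axis i 1) - s *\<^sub>R c" for s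
  have "norm (u t - u 0) \<le> B * norm (t - 0)"
  proof (rule differentiable_bound[OF convex_closed_segment])
    show "(u has_derivative (\<lambda>h. h *\<^sub>R (partial_deriv (*) i f (x + s *\<^sub>R axis i 1) - c)))
        (at s within closed_segment 0 t)" if "s \<in> closed_segment 0 t" for s
    proof -
      have "(u has_vector_derivative (partial_deriv (*) i f (x + s *\<^sub>R axis i 1) - c))
        (at s within closed_segment 0 t)"
        unfolding u_def using axis_has_vector_derivative[OF assms(1)[OF that]]
        by (auto intro!: derivative_eq_intros)
      then show ?thesis by (simp add: has_vector_derivative_def)
    qed
    show "onorm (\<lambda>h. h *\<^sub>R (partial_deriv (*) i f (x + s *\<^sub>R axis i 1) - c)) \<le> B"
      if "s \<in> closed_segment 0 t" for s
      using assms(2)[OF that] by (intro onorm_le) (simp add: mult.commute[of B] mult_left_mono)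
  qed auto
  then show ?thesis by (simp add: u_def algebra_simps)
qed

lemma closed_segment_zero_abs_le:
  assumes "s \<in> closed_segment 0 (t::real)"
  shows "\<bar>s\<bar> \<le> \<bar>t\<bar>"
  using assms by (auto simp: closed_segment_eq_real_ivl split: if_splits)

lemma has_partial_deriv_shift_diff:
  fixes f :: "real^'d::finite \<Rightarrow> 'k::real_normed_field"
  assumes "has_partial_deriv (*) i f (y + v)" "has_partial_deriv (*) i f y"
  shows "has_partial_deriv (*) i (\<lambda>z. f (z + v) - f z) y"
    and "partial_deriv (*) i (\<lambda>z. f (z + v) - f z) y = partial_deriv (*) i f (y + v) - partial_deriv (*) i f y"
proof -
  have "(diff_quot (*) i (\<lambda>z. f (z + v) - f z) y \<longlongrightarrow>
      partial_deriv (*) i f (y + v) - partial_deriv (*) i f y) (at 0)"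
    by (rule Lim_transform_eventually[OF tendsto_diff[OF assms[THEN has_partial_deriv_tendsto]]])
       (simp add: diff_quot_def diff_divide_distrib add_ac)
  then show "has_partial_deriv (*) i (\<lambda>z. f (z + v) - f z) y"
    "partial_deriv (*) i (\<lambda>z. f (z + v) - f z) y = partial_deriv (*) i f (y + v) - partial_deriv (*) i f y"
    using partial_deriv_unique by (auto simp: has_partial_deriv_def)
qed

text \<open>The second difference is the increment along axis \<open>i\<close> of the increment
  \<open>A\<close> of \<open>f\<close> along axis \<open>j\<close>. An inner mean value inequality
  along \<open>j\<close> controls the derivative of \<open>A\<close>, an outer one along
  \<open>i\<close> controls \<open>A\<close>. The ball of radius \<open>2 * \<bar>h\<bar>\<close>
  contains all points visited.\<close>

lemma second_difference_approx:
  fixes f :: "real^'d::finite \<Rightarrow> 'k::real_normed_field"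
  assumes "\<And>y. y \<in> cball x (2 * \<bar>h\<bar>) \<Longrightarrow> has_partial_deriv (*) i f y"
    and "\<And>y. y \<in> cball x (2 * \<bar>h\<bar>) \<Longrightarrow> has_partial_deriv (*) j (partial_deriv (*) i f) y"
    and "\<And>y. y \<in> cball x (2 * \<bar>h\<bar>) \<Longrightarrow>
          norm (partial_deriv (*) j (partial_deriv (*) i f) y - c) \<le> \<epsilon>"
  shows "norm (f (x + h *\<^sub>R axis i 1 + h *\<^sub>R axis j 1) - f (x + h *\<^sub>R axis i 1)
           - f (x + h *\<^sub>R axis j 1) + f x - (h * h) *\<^sub>R c) \<le> \<epsilon> * (h * h)"
proof -
  have in_ball: "x + s *\<^sub>R axis i 1 + r *\<^sub>R axis j 1 \<in> cball x (2 * \<bar>h\<bar>)"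
    if "s \<in> closed_segment 0 h" "r \<in> closed_segment 0 h" for s r
  proof -
    have "norm (s *\<^sub>R axis i (1::real) + r *\<^sub>R axis j 1) \<le> \<bar>s\<bar> + \<bar>r\<bar>"
      by (rule order_trans[OF norm_triangle_ineq]) simp
    also have "\<dots> \<le> 2 * \<bar>h\<bar>"
      using that[THEN closed_segment_zero_abs_le] by simp
    finally show ?thesis
      unfolding mem_cball dist_norm norm_minus_commute[of x] by (simp add: add.assoc)
  qed
  have end_in: "0 \<in> closed_segment 0 h" "h \<in> closed_segment 0 h" by auto
  define A where "A y = f (y + h *\<^sub>R axis j 1) - f y" for y
  have A: "has_partial_deriv (*) i A (x + s *\<^sub>R axis i 1)"
    "partial_deriv (*) i A (x + s *\<^sub>R axis i 1) =
      partial_deriv (*) i f (x + s *\<^sub>R axis i 1 + h *\<^sub>R axis j 1) - partial_deriv (*) i f (x + s *\<^sub>R axis i 1)"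
    if "s \<in> closed_segment 0 h" for s
  proof -
    have "has_partial_deriv (*) i f (x + s *\<^sub>R axis i 1 + h *\<^sub>R axis j 1)"
      "has_partial_deriv (*) i f (x + s *\<^sub>R axis i 1)"
      using assms(1)[OF in_ball[OF that end_in(2)]] assms(1)[OF in_ball[OF that end_in(1)]] by simp_all
    from has_partial_deriv_shift_diff[OF this]
    show "has_partial_deriv (*) i A (x + s *\<^sub>R axis i 1)"
    "partial_deriv (*) i A (x + s *\<^sub>R axis i 1) =
      partial_deriv (*) i f (x + s *\<^sub>R axis i 1 + h *\<^sub>R axis j 1) - partial_deriv (*) i f (x + s *\<^sub>R axis i 1)"
      unfolding A_def .
  qed
  have "norm (A (x + h *\<^sub>R axis i 1) - A x - h *\<^sub>R (h *\<^sub>R c)) \<le> \<epsilon> * \<bar>h\<bar> * \<bar>h\<bar>"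
  proof (rule axis_mean_value)
    fix s assume s: "s \<in> closed_segment 0 h"
    show "has_partial_deriv (*) i A (x + s *\<^sub>R axis i 1)"
      using A s by blast
    show "norm (partial_deriv (*) i A (x + s *\<^sub>R axis i 1) - h *\<^sub>R c) \<le> \<epsilon> * \<bar>h\<bar>"
      unfolding A(2)[OF s] using in_ball[OF s] assms(2,3) by (intro axis_mean_value) auto
  qed
  then show ?thesis
    by (simp add: A_def algebra_simps abs_mult_self_eq)
qed

text \<open>Schwarz's theorem: the second difference of \<open>f\<close> is symmetric in
  \<open>i\<close> and \<open>j\<close>, and divided by \<open>h * h\<close> it is close to both
  mixed derivatives.\<close>

lemma partial_deriv_commute:
  fixes f :: "real^'d::finite \<Rightarrow> 'k::real_normed_field"
  assumes "open \<Omega>" "x \<in> \<Omega>" "cont_partially_diff (*) (Suc (Suc k)) \<Omega> f"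
  shows "partial_deriv (*) i (partial_deriv (*) j f) x = partial_deriv (*) j (partial_deriv (*) i f) x"
    (is "?a = ?b")
proof -
  have diff: "has_partial_deriv (*) i f y" "has_partial_deriv (*) j (partial_deriv (*) i f) y"
    if "y \<in> \<Omega>" for i j y
    using assms(3) that by simp_all
  have cont: "continuous_on \<Omega> (partial_deriv (*) j (partial_deriv (*) i f))" for i j
  proof (rule cont_partially_diff_continuous)
    show "cont_partially_diff (*) k \<Omega> (partial_deriv (*) j (partial_deriv (*) i f))"
      using assms(3) by simp
  qed
  have near: "\<exists>d>0. (\<forall>y. dist x y < d \<longrightarrow> y \<in> \<Omega>) \<and> (\<forall>y. dist x y < d \<longrightarrow>
      norm (partial_deriv (*) j (partial_deriv (*) i f) y - partial_deriv (*) j (partial_deriv (*) i f) x) \<le> \<epsilon>)"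
    if "\<epsilon> > 0" for \<epsilon> i j
  proof -
    have "isCont (partial_deriv (*) j (partial_deriv (*) i f)) x"
      using cont assms(1,2) continuous_on_eq_continuous_at by blast
    then have "\<forall>\<^sub>F y in nhds x. dist (partial_deriv (*) j (partial_deriv (*) i f) y)
        (partial_deriv (*) j (partial_deriv (*) i f) x) < \<epsilon>"
      using that tendstoD unfolding continuous_at tendsto_at_iff_tendsto_nhds by blast
    then obtain d where d: "d > 0" "\<And>y. dist y x < d \<Longrightarrow>
      norm (partial_deriv (*) j (partial_deriv (*) i f) y - partial_deriv (*) j (partial_deriv (*) i f) x) < \<epsilon>"
      unfolding eventually_nhds_metric dist_norm[where 'a='k] by blast
    obtain d' where "d' > 0" "\<And>y. dist y x < d' \<Longrightarrow> y \<in> \<Omega>"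
      using assms(1,2) unfolding open_dist by blast
    with d show ?thesis
      by (intro exI[of _ "min d d'"]) (simp add: dist_commute less_imp_le)
  qed
  have "norm (?a - ?b) \<le> \<epsilon>" if eps: "\<epsilon> > 0" for \<epsilon>
  proof -
    obtain d1 where d1: "d1 > 0" "\<And>y. dist x y < d1 \<Longrightarrow> y \<in> \<Omega>"
      "\<And>y. dist x y < d1 \<Longrightarrow> norm (partial_deriv (*) i (partial_deriv (*) j f) y - ?a) \<le> \<epsilon> / 2"
      using near[OF half_gt_zero[OF eps], where i=j and j=i] by blast
    obtain d2 where d2: "d2 > 0" 
      "\<And>y. dist x y < d2 \<Longrightarrow> norm (partial_deriv (*) j (partial_deriv (*) i f) y - ?b) \<le> \<epsilon> / 2"
      using near[OF half_gt_zero[OF eps], where i=i and j=j] by blast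
    \<comment> \<open>The divisor 3 puts the ball of radius \<open>2 * \<bar>h\<bar>\<close>
      strictly inside both neighbourhoods.\<close>
    define h where "h = min d1 d2 / 3"
    have h: "h > 0" "2 * \<bar>h\<bar> < d1" "2 * \<bar>h\<bar> < d2"
      using d1(1) d2(1) by (auto simp: h_def min_def)
    define D where "D = f (x + h *\<^sub>R axis i 1 + h *\<^sub>R axis j 1) - f (x + h *\<^sub>R axis i 1)
           - f (x + h *\<^sub>R axis j 1) + f x"
    have near_x: "dist x y < d1" "dist x y < d2" if "y \<in> cball x (2 * \<bar>h\<bar>)" for y
      using h that by simp_all
    have b: "norm (D - (h * h) *\<^sub>R ?b) \<le> \<epsilon> / 2 * (h * h)"
      unfolding D_def using near_x d1(2) d2(2) diff by (intro second_difference_approx) blast+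
    \<comment> \<open>The same estimate with the axes exchanged; by symmetry the second difference
      is again \<open>D\<close>.\<close>
    have "norm (f (x + h *\<^sub>R axis j 1 + h *\<^sub>R axis i 1) - f (x + h *\<^sub>R axis j 1)
           - f (x + h *\<^sub>R axis i 1) + f x - (h * h) *\<^sub>R ?a) \<le> \<epsilon> / 2 * (h * h)"
      using near_x d1(2,3) diff by (intro second_difference_approx) blast+
    then have a: "norm (D - (h * h) *\<^sub>R ?a) \<le> \<epsilon> / 2 * (h * h)"
      unfolding D_def by (simp add: algebra_simps)
    have "(h * h) * norm (?a - ?b) = norm ((h * h) *\<^sub>R (?a - ?b))"
      by simp
    also have "\<dots> = norm ((D - (h * h) *\<^sub>R ?b) - (D - (h * h) *\<^sub>R ?a))"
      by (simp add: algebra_simps)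
    also have "\<dots> \<le> \<epsilon> / 2 * (h * h) + \<epsilon> / 2 * (h * h)"
      by (rule order_trans[OF norm_triangle_ineq4 add_mono[OF b a]])
    finally have "(h * h) * norm (?a - ?b) \<le> (h * h) * \<epsilon>"
      by (simp add: algebra_simps)
    then show ?thesis using h by simp
  qed
  then have "norm (?a - ?b) \<le> 0"
    by (rule dense_ge)
  then show ?thesis by simp
qed

text \<open>\<open>insort\<close> moves \<open>i\<close> inwards past smaller entries, and every
  entry passed costs one use of \<open>partial_deriv_commute\<close>.\<close>

lemma iterated_partial_deriv_insort:
  fixes f :: "(real, 'd::{finite,linorder}) vec \<Rightarrow> 'k::real_normed_field"
  assumes "open \<Omega>" "cont_partially_diff (*) k \<Omega> f" "Suc (length is) \<le> k" "x \<in> \<Omega>"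
  shows "foldr (partial_deriv (*)) (insort i is) f x = foldr (partial_deriv (*)) (i # is) f x"
  using assms(3,4)
proof (induction "is" arbitrary: x)
  case (Cons j "is")
  define g where "g = foldr (partial_deriv (*)) is f"
  \<comment> \<open>Both \<open>i\<close> and \<open>j\<close> are still to be applied to
    \<open>g\<close>, so at least two orders of differentiability remain.\<close>
  obtain m where m: "k - length is = Suc (Suc m)"
    using Cons.prems that[of "k - length is - 2"] by simp
  have "cont_partially_diff (*) (Suc (Suc m)) \<Omega> g"
    using cont_partially_diff_iterate[OF assms(2), of "is"] Cons.prems m by (simp add: g_def)
  then have *: "partial_deriv (*) j (partial_deriv (*) i g) x = partial_deriv (*) i (partial_deriv (*) j g) x"
    using partial_deriv_commute[OF assms(1) Cons.prems(2)] by blast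
  have "partial_deriv (*) j (foldr (partial_deriv (*)) (insort i is) f) x
      = partial_deriv (*) j (partial_deriv (*) i g) x"
    using Cons.prems Cons.IH by (intro partial_deriv_cong[OF assms(1)]) (auto simp: g_def)
  with * show ?case by (simp add: g_def)
qed simp

text \<open>Insertion sort, one insertion per entry. The induction hypothesis holds only on
  \<Omega>, which suffices under a further derivative because \<Omega> is open.\<close>

lemma iterated_partial_deriv_sort:
  fixes f :: "(real, 'd::{finite,linorder}) vec \<Rightarrow> 'k::real_normed_field"
  assumes "open \<Omega>" "cont_partially_diff (*) k \<Omega> f" "length is \<le> k" "x \<in> \<Omega>"
  shows "foldr (partial_deriv (*)) (sort is) f x = foldr (partial_deriv (*)) is f x"
  using assms(3,4)
proof (induction "is" arbitrary: x)
  case (Cons i "is")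
  have "foldr (partial_deriv (*)) (sort (i # is)) f x = foldr (partial_deriv (*)) (i # sort is) f x"
    using iterated_partial_deriv_insort[OF assms(1,2), of "sort is" x i] Cons.prems by simp
  also have "\<dots> = foldr (partial_deriv (*)) (i # is) f x"
    using Cons by (auto intro: partial_deriv_cong[OF assms(1)])
  finally show ?case .
qed simp

text \<open>The multi-index as the sorted word of coordinates that \<open>multi_deriv\<close> works
  through; words allow induction over single derivatives.\<close>

definition multi_index_list :: "('d::{finite,linorder} \<Rightarrow> nat) \<Rightarrow> 'd list"
  where "multi_index_list \<beta> = concat (map (\<lambda>i. replicate (\<beta> i) i) (sorted_list_of_set UNIV))"

lemma multi_deriv_eq_foldr:
  "multi_deriv smul \<beta> f = foldr (partial_deriv smul) (multi_index_list \<beta>) f"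
proof -
  have rep: "foldr (partial_deriv smul) (replicate n i) g = (partial_deriv smul i ^^ n) g" for n i g
    by (induction n) auto
  have "foldr (\<lambda>i. partial_deriv smul i ^^ \<beta> i) js f
      = foldr (partial_deriv smul) (concat (map (\<lambda>i. replicate (\<beta> i) i) js)) f" for js
    by (induction js) (auto simp: rep)
  then show ?thesis by (simp add: multi_deriv_def multi_index_list_def)
qed

lemma length_multi_index_list: "length (multi_index_list \<beta>) = (\<Sum>i\<in>UNIV. \<beta> i)"
proof -
  have "length (multi_index_list \<beta>) = sum_list (map \<beta> (sorted_list_of_set UNIV))"
    by (simp add: multi_index_list_def length_concat o_def)
  also have "\<dots> = (\<Sum>i\<in>UNIV. \<beta> i)"
    by (simp add: sum_list_distinct_conv_sum_set)
  finally show ?thesis .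
qed

text \<open>A sorted list is determined by its multiset of entries. With
  \<open>iterated_partial_deriv_sort\<close>, any order of differentiation becomes a multi-index
  derivative.\<close>

lemma sort_eq_multi_index_list:
  "sort is = multi_index_list (count_list is)"
proof (rule properties_for_sort)
  have "sorted (concat (map (\<lambda>i. replicate (b i) i) js))" if "sorted js" for b and js :: "'a list"
    using that by (induction js) (auto simp: sorted_append)
  then show "sorted (multi_index_list (count_list is))"
    by (simp add: multi_index_list_def)
  have r: "count_list (replicate n i) i = n" for n and i :: 'a
    by (induction n) auto
  have c: "count_list (concat (map (\<lambda>i. replicate (b i) i) js)) i = (if i \<in> set js then b i else 0)"
    if "distinct js" for b and js :: "'a list" and i
    using that by (induction js) (auto simp: count_list_0_iff r)
  show "mset (multi_index_list (count_list is)) = mset is"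
    by (rule multiset_eqI)
       (simp add: multi_index_list_def c count_mset)
qed


section \<open>Local Hoelder conditions and their verification for scalar functions\<close>

section \<open>Local Hoelder continuity\<close>

text \<open>The quotient condition is multiplied out so that the diagonal needs no exception: for a
  seminorm both sides vanish there, as \<open>0 powr \<gamma> = 0\<close>.\<close>

definition locally_Holder :: "('e::ab_group_add \<Rightarrow> real) set \<Rightarrow> real \<Rightarrow> (real^'d::finite) set \<Rightarrow>
    (real^'d \<Rightarrow> 'e) \<Rightarrow> bool"
  where "locally_Holder P \<gamma> \<Omega> f \<longleftrightarrow> (\<forall>K p. compact K \<longrightarrow> K \<subseteq> \<Omega> \<longrightarrow> p \<in> P \<longrightarrow>
    (\<exists>C. \<forall>x\<in>K. \<forall>y\<in>K. p (f x - f y) \<le> C * norm (x - y) powr \<gamma>))"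

lemma locally_Holder_cong:
  assumes "locally_Holder P \<gamma> \<Omega> f" "\<And>x. x \<in> \<Omega> \<Longrightarrow> f x = g x"
  shows "locally_Holder P \<gamma> \<Omega> g"
  unfolding locally_Holder_def
proof (intro allI impI)
  fix K p assume K: "compact K" "K \<subseteq> \<Omega>" "p \<in> P"
  then obtain C where "\<forall>x\<in>K. \<forall>y\<in>K. p (f x - f y) \<le> C * norm (x - y) powr \<gamma>"
    using assms(1) unfolding locally_Holder_def by blast
  moreover have "f x = g x" if "x \<in> K" for x
    using assms(2) K(2) that by blast
  ultimately show "\<exists>C. \<forall>x\<in>K. \<forall>y\<in>K. p (g x - g y) \<le> C * norm (x - y) powr \<gamma>"
    by auto
qed

text \<open>The coordinates of \<open>x\<close> are changed into those of \<open>y\<close> one at a time; this moves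
  monotonically away from \<open>x\<close> and hence stays in the ball.\<close>

lemma bounded_partial_derivs_imp_lipschitz:
  fixes f :: "real^'d::finite \<Rightarrow> 'k::real_normed_field" and C :: real
  assumes "\<And>z i. z \<in> cball x (norm (y - x)) \<Longrightarrow> has_partial_deriv (*) i f z"
    and "\<And>z i. z \<in> cball x (norm (y - x)) \<Longrightarrow> norm (partial_deriv (*) i f z) \<le> C"
  shows "norm (f y - f x) \<le> CARD('d) * C * norm (y - x)"
proof -
  define w where "w S = (\<chi> i. if i \<in> S then y $ i else x $ i)" for S
  have C: "C \<ge> 0"
    using assms(2)[of x] norm_ge_zero order_trans by (metis centre_in_cball norm_ge_zero)
  have "norm (f (w S) - f x) \<le> card S * (C * norm (y - x))" if "finite S" for S
    using that
  proof (induction S)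
    case empty
    have "w {} = x" by (simp add: w_def vec_eq_iff)
    then show ?case by simp
  next
    case (insert i S)
    define t where "t = y $ i - x $ i"
    have t: "\<bar>t\<bar> \<le> norm (y - x)"
      unfolding t_def using component_le_norm_cart[of "y - x" i] by simp
    have ins: "w (insert i S) = w S + t *\<^sub>R axis i 1"
      using insert.hyps by (auto simp: w_def vec_eq_iff axis_def t_def)
    have in_ball: "w S + s *\<^sub>R axis i 1 \<in> cball x (norm (y - x))" if "s \<in> closed_segment 0 t" for s
    proof -
      \<comment> \<open>Each coordinate of the moved point deviates from that of \<open>x\<close> by
        at most the deviation of \<open>y\<close>.\<close>
      have "norm (w S + s *\<^sub>R axis i 1 - x) \<le> norm (y - x)"
        using insert.hyps closed_segment_zero_abs_le[OF that]
        by (intro norm_le_componentwise_cart) (auto simp: w_def axis_def t_def)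
      then show ?thesis by (simp add: dist_norm norm_minus_commute)
    qed
    have "norm (f (w (insert i S)) - f (w S) - t *\<^sub>R 0) \<le> C * \<bar>t\<bar>"
      unfolding ins using assms in_ball by (intro axis_mean_value) auto
    also have "\<dots> \<le> C * norm (y - x)"
      using t C by (rule mult_left_mono)
    finally have "norm (f (w (insert i S)) - f (w S)) \<le> C * norm (y - x)" by simp
    then have "norm ((f (w (insert i S)) - f (w S)) + (f (w S) - f x))
        \<le> C * norm (y - x) + card S * (C * norm (y - x))"
      using insert.IH by (intro norm_triangle_mono)
    then show ?case
      using insert.hyps by (simp add: algebra_simps)
  qed
  from this[of UNIV] show ?thesis
    by (simp add: w_def)
qed

text \<open>\<open>K\<close> may fail to be convex, so the estimate by partial derivatives serves
  pairs at distance at most \<open>\<delta>\<close>; for distant pairs the boundedness of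
  \<open>f\<close> on \<open>K\<close> suffices. The finite diameter of \<open>K\<close> turns the
  Lipschitz bound into a Hoelder bound.\<close>

lemma C1_imp_locally_Holder:
  fixes f :: "real^'d::finite \<Rightarrow> 'k::real_normed_field"
  assumes "open \<Omega>" "\<gamma> \<le> 1" "cont_partially_diff (*) (Suc k) \<Omega> f"
  shows "locally_Holder {norm} \<gamma> \<Omega> f"
  unfolding locally_Holder_def
proof (intro allI impI)
  fix K p assume K: "compact K" "K \<subseteq> \<Omega>" and p: "p \<in> {norm :: 'k \<Rightarrow> real}"
  show "\<exists>C. \<forall>x\<in>K. \<forall>y\<in>K. p (f x - f y) \<le> C * norm (x - y) powr \<gamma>"
  proof (cases "K = {}")
    case False
    obtain \<delta> where \<delta>: "\<delta> > 0" "{x. infdist x K \<le> \<delta>} \<subseteq> \<Omega>"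
      using compact_in_open_separated[OF False K(1) assms(1) K(2)] by blast
    \<comment> \<open>\<open>K'\<close> is compact, lies in \<Omega> and contains every ball of
      radius at most \<open>\<delta>\<close> around a point of \<open>K\<close>.\<close>
    define K' where "K' = {x. infdist x K \<le> \<delta>}"
    have K': "compact K'" "K' \<subseteq> \<Omega>"
      using compact_infdist_le[OF False K(1) \<delta>(1)] \<delta>(2) by (auto simp: K'_def)
    have bdd: "\<exists>B. \<forall>x\<in>L. norm (g x) \<le> B"
      if "compact L" "L \<subseteq> \<Omega>" "continuous_on \<Omega> g" for L and g :: "real^'d \<Rightarrow> 'k"
      using compact_imp_bounded[OF compact_continuous_image[of L g]] that continuous_on_subset
      by (force simp: bounded_iff)
    have "\<exists>B. \<forall>x\<in>K'. norm (partial_deriv (*) i f x) \<le> B" for i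
    proof (rule bdd[OF K'])
      have "cont_partially_diff (*) k \<Omega> (partial_deriv (*) i f)"
        using assms(3) by simp
      then show "continuous_on \<Omega> (partial_deriv (*) i f)"
        by (rule cont_partially_diff_continuous)
    qed
    then obtain B where B: "\<And>i x. x \<in> K' \<Longrightarrow> norm (partial_deriv (*) i f x) \<le> B i"
      by metis
    define C where "C = (\<Sum>i\<in>UNIV. \<bar>B i\<bar>)"
    have C0: "C \<ge> 0" by (simp add: C_def sum_nonneg)
    have C: "norm (partial_deriv (*) i f x) \<le> C" if "x \<in> K'" for i x
    proof -
      have "norm (partial_deriv (*) i f x) \<le> \<bar>B i\<bar>"
        using B[OF that, of i] by linarith
      also have "\<dots> \<le> C"
        unfolding C_def by (rule member_le_sum) auto
      finally show ?thesis .
    qed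
    obtain M where M: "\<And>x. x \<in> K \<Longrightarrow> norm (f x) \<le> M"
      using bdd[OF K cont_partially_diff_continuous[OF assms(3)]] by blast
    have M0: "M \<ge> 0"
      using False M norm_ge_zero order_trans by (metis ex_in_conv)
    \<comment> \<open>The summands are the Lipschitz constants for close and for distant
      pairs.\<close>
    define L where "L = CARD('d) * C + 2 * M / \<delta>"
    have L0: "L \<ge> 0"
      using C0 M0 \<delta>(1) by (simp add: L_def)
    have lip: "norm (f x - f y) \<le> L * norm (x - y)" if xy: "x \<in> K" "y \<in> K" for x y
    proof (cases "norm (x - y) \<le> \<delta>")
      case True
      have sub: "cball y (norm (x - y)) \<subseteq> K'"
      proof
        fix z assume "z \<in> cball y (norm (x - y))"
        then have "dist z y \<le> \<delta>" using True by (simp add: dist_commute)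
        then show "z \<in> K'"
          unfolding K'_def using infdist_le2[OF xy(2)] by simp
      qed
      have "norm (f x - f y) \<le> CARD('d) * C * norm (x - y)"
      proof (rule bounded_partial_derivs_imp_lipschitz[where f = f and x = y and y = x])
        fix z i assume "z \<in> cball y (norm (x - y))"
        then have "z \<in> K'" using sub by blast
        then show "norm (partial_deriv (*) i f z) \<le> C" "has_partial_deriv (*) i f z"
          using C K'(2) assms(3) by auto
      qed
      also have "\<dots> \<le> L * norm (x - y)"
        using M0 \<delta>(1) by (intro mult_right_mono) (auto simp: L_def)
      finally show ?thesis .
    next
      case False
      have "norm (f x - f y) \<le> 2 * M"
        using norm_triangle_ineq4[of "f x" "f y"] M[OF xy(1)] M[OF xy(2)] by linarith
      also have "\<dots> = 2 * M / \<delta> * \<delta>"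
        using \<delta>(1) by simp
      also have "\<dots> \<le> 2 * M / \<delta> * norm (x - y)"
        using False M0 \<delta>(1) by (intro mult_left_mono) auto
      also have "\<dots> \<le> L * norm (x - y)"
        using C0 by (intro mult_right_mono) (auto simp: L_def)
      finally show ?thesis .
    qed
    \<comment> \<open>The distance is split into its powers with exponents
      \<open>1 - \<gamma>\<close> and \<open>\<gamma>\<close>. As \<open>1 - \<gamma>\<close> is
      nonnegative, the first power is at most that of the diameter.\<close>
    define R where "R = diameter K"
    have "norm (f x - f y) \<le> L * R powr (1 - \<gamma>) * norm (x - y) powr \<gamma>" if xy: "x \<in> K" "y \<in> K" for x y
    proof -
      have R: "norm (x - y) \<le> R"
        using diameter_bounded_bound[OF compact_imp_bounded[OF K(1)] xy] by (simp add: R_def dist_norm)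
      have "norm (x - y) \<le> norm (x - y) powr (1 - \<gamma>) * norm (x - y) powr \<gamma>"
        by (simp flip: powr_add)
      also have "\<dots> \<le> R powr (1 - \<gamma>) * norm (x - y) powr \<gamma>"
        using R assms(2) by (intro mult_right_mono powr_mono2) auto
      finally have "L * norm (x - y) \<le> L * (R powr (1 - \<gamma>) * norm (x - y) powr \<gamma>)"
        using L0 by (rule mult_left_mono)
      then show ?thesis
        using lip[OF xy] by (simp add: mult.assoc)
    qed
    then show ?thesis using p by auto
  qed simp
qed

text \<open>Words of every order and every length up to \<open>k\<close> occur, not only sorted ones
  of length \<open>k\<close>. This permits induction, and the lower orders supply continuity, local
  boundedness and, for vector values, the existence of derivatives.\<close>

definition iterated_Holder :: "('k::real_normed_field \<Rightarrow> 'e::{ab_group_add,t2_space} \<Rightarrow> 'e) \<Rightarrow>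
    ('e \<Rightarrow> real) set \<Rightarrow> nat \<Rightarrow> real \<Rightarrow> (real^'d::finite) set \<Rightarrow> (real^'d \<Rightarrow> 'e) \<Rightarrow> bool"
  where "iterated_Holder smul P k \<gamma> \<Omega> f \<longleftrightarrow>
    (\<forall>is. length is \<le> k \<longrightarrow> locally_Holder P \<gamma> \<Omega> (foldr (partial_deriv smul) is f)) \<and>
    (\<forall>is i x. length is < k \<longrightarrow> x \<in> \<Omega> \<longrightarrow> has_partial_deriv smul i (foldr (partial_deriv smul) is f) x)"

text \<open>Below order \<open>k\<close> one more continuous derivative is available, so
  \<open>C1_imp_locally_Holder\<close> applies to the iterated derivative itself.\<close>

lemma iterated_Holder_lower:
  fixes f :: "real^'d::finite \<Rightarrow> 'k::real_normed_field"
  assumes "open \<Omega>" "\<gamma> \<le> 1" "cont_partially_diff (*) k \<Omega> f" "length is < k"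
  shows "locally_Holder {norm} \<gamma> \<Omega> (foldr (partial_deriv (*)) is f)"
    and "x \<in> \<Omega> \<Longrightarrow> has_partial_deriv (*) i (foldr (partial_deriv (*)) is f) x"
proof -
  obtain m where "k - length is = Suc m"
    using assms(4) by (metis Suc_diff_Suc)
  then have *: "cont_partially_diff (*) (Suc m) \<Omega> (foldr (partial_deriv (*)) is f)"
    using cont_partially_diff_iterate[OF assms(3), of "is"] assms(4) by simp
  then show "locally_Holder {norm} \<gamma> \<Omega> (foldr (partial_deriv (*)) is f)"
    by (rule C1_imp_locally_Holder[OF assms(1,2)])
  show "x \<in> \<Omega> \<Longrightarrow> has_partial_deriv (*) i (foldr (partial_deriv (*)) is f) x"
    using * by simp
qed

lemma C_space_imp_iterated_Holder:
  fixes f :: "real^'d::finite \<Rightarrow> 'k::real_normed_field"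
  assumes "open \<Omega>" "\<gamma> \<le> 1" "f \<in> C_space (*) (k + 1) \<Omega>"
  shows "iterated_Holder (*) {norm} k \<gamma> \<Omega> f"
  using assms iterated_Holder_lower[of \<Omega> \<gamma> "k + 1" f]
  by (simp add: iterated_Holder_def C_space_def)

text \<open>Only words of length exactly \<open>k\<close> draw on the Hoelder hypothesis; shorter
  ones are covered by \<open>iterated_Holder_lower\<close>.\<close>

lemma C_loc_space_imp_iterated_Holder:
  fixes f :: "(real, 'd::{finite,linorder}) vec \<Rightarrow> 'k::real_normed_field"
  assumes "open \<Omega>" "\<gamma> \<le> 1" "f \<in> C_loc_space (*) {norm} k \<gamma> \<Omega>"
  shows "iterated_Holder (*) {norm} k \<gamma> \<Omega> f"
proof -
  have Ck: "cont_partially_diff (*) k \<Omega> f"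
    using assms(3) by (simp add: C_loc_space_def C_space_def)
  have "locally_Holder {norm} \<gamma> \<Omega> (foldr (partial_deriv (*)) is f)" if "length is \<le> k" for "is"
  proof (cases "length is < k")
    case True
    then show ?thesis by (rule iterated_Holder_lower(1)[OF assms(1,2) Ck])
  next
    case False
    \<comment> \<open>\<open>count_list is\<close> is the multi-index of the word \<open>is\<close>;
      sorting the word leaves the derivative unchanged on \<Omega>.\<close>
    define g where "g = multi_deriv (*) (count_list is) f"
    have eq: "g x = foldr (partial_deriv (*)) is f x" if "x \<in> \<Omega>" for x
      using iterated_partial_deriv_sort[OF assms(1) Ck \<open>length is \<le> k\<close> that]
      by (simp add: g_def multi_deriv_eq_foldr flip: sort_eq_multi_index_list)
    have "(\<Sum>i\<in>UNIV. count_list is i) = k"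
      using False that length_multi_index_list[of "count_list is"]
      by (simp flip: sort_eq_multi_index_list)
    then have bdd: "bdd_above {norm (g x - g y) / norm (x - y) powr \<gamma> | x y. x \<in> K \<and> y \<in> K \<and> x \<noteq> y}"
      if "compact K" "K \<subseteq> \<Omega>" for K
      using assms(3) that by (auto simp: C_loc_space_def g_def)
    have "locally_Holder {norm} \<gamma> \<Omega> g"
      unfolding locally_Holder_def
    proof (intro allI impI)
      fix K p assume K: "compact K" "K \<subseteq> \<Omega>" and p: "p \<in> {norm :: 'k \<Rightarrow> real}"
      obtain C where C: "\<And>x y. x \<in> K \<Longrightarrow> y \<in> K \<Longrightarrow> x \<noteq> y \<Longrightarrow> norm (g x - g y) / norm (x - y) powr \<gamma> \<le> C"
        using bdd[OF K] unfolding bdd_above_def by blast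
      have "norm (g x - g y) \<le> C * norm (x - y) powr \<gamma>" if "x \<in> K" "y \<in> K" for x y
        using C[OF that] by (cases "x = y") (auto simp: pos_divide_le_eq)
      then show "\<exists>C. \<forall>x\<in>K. \<forall>y\<in>K. p (g x - g y) \<le> C * norm (x - y) powr \<gamma>"
        using p by auto
    qed
    then show ?thesis using locally_Holder_cong eq by blast
  qed
  then show ?thesis
    using iterated_Holder_lower(2)[OF assms(1,2) Ck] by (simp add: iterated_Holder_def)
qed

section \<open>Seminorms, convergence, and the return from words to function spaces\<close>

section \<open>Locally convex spaces\<close>

locale lcs =
  fixes smul :: "'k::real_normed_field \<Rightarrow> 'e::{ab_group_add,t2_space} \<Rightarrow> 'e"
    and P :: "('e \<Rightarrow> real) set"
  assumes lcHs: "lcHs smul P"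
begin

sublocale vector_space smul
  using lcHs by (simp add: lcHs_def)

lemma open_iff: "open U \<longleftrightarrow> (\<forall>x\<in>U. \<exists>p\<in>P. \<exists>\<epsilon>>0. {y. p (y - x) < \<epsilon>} \<subseteq> U)"
  using lcHs by (simp add: lcHs_def)

context
  fixes p assumes p: "p \<in> P"
begin

lemma seminorm_nonneg: "0 \<le> p x"
  and seminorm_smul: "p (smul c x) = norm c * p x"
  and seminorm_triangle: "p (x + y) \<le> p x + p y"
  using lcHs p by (auto simp: lcHs_def seminorm_def)

lemma seminorm_zero: "p 0 = 0"
  using seminorm_smul[of 0 0] by simp

lemma seminorm_minus: "p (- x) = p x"
  using seminorm_smul[of "-1" x] by simp

lemma seminorm_diff_commute: "p (x - y) = p (y - x)"
  using seminorm_minus[of "x - y"] by simp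

lemma seminorm_diff_triangle: "p (x - z) \<le> p (x - y) + p (y - z)"
  using seminorm_triangle[of "x - y" "y - z"] by simp

end

lemma open_seminorm_ball:
  assumes p: "p \<in> P"
  shows "open {y. p (y - x) < \<epsilon>}"
  unfolding open_iff
proof safe
  fix y assume y: "p (y - x) < \<epsilon>"
  have "{z. p (z - y) < \<epsilon> - p (y - x)} \<subseteq> {y. p (y - x) < \<epsilon>}"
  proof safe
    fix z assume "p (z - y) < \<epsilon> - p (y - x)"
    then show "p (z - x) < \<epsilon>"
      using seminorm_diff_triangle[OF p, of z x y] by simp
  qed
  then show "\<exists>q\<in>P. \<exists>\<epsilon>'>0. {z. q (z - y) < \<epsilon>'} \<subseteq> {y. p (y - x) < \<epsilon>}"
    using p y by (intro bexI[of _ p] exI[of _ "\<epsilon> - p (y - x)"]) auto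
qed

text \<open>By \<open>open_iff\<close>, balls of single seminorms form a neighbourhood basis, so
  limits in the space reduce to real limits.\<close>

lemma tendsto_iff_seminorms:
  "(f \<longlongrightarrow> l) F \<longleftrightarrow> (\<forall>p\<in>P. ((\<lambda>x. p (f x - l)) \<longlongrightarrow> 0) F)"
proof safe
  fix p assume f: "(f \<longlongrightarrow> l) F" and p: "p \<in> P"
  show "((\<lambda>x. p (f x - l)) \<longlongrightarrow> 0) F"
  proof (rule tendstoI)
    fix \<epsilon> :: real assume "\<epsilon> > 0"
    then have "\<forall>\<^sub>F x in F. f x \<in> {y. p (y - l) < \<epsilon>}"
      using topological_tendstoD[OF f open_seminorm_ball[OF p]] seminorm_zero[OF p] by simp
    then show "\<forall>\<^sub>F x in F. dist (p (f x - l)) 0 < \<epsilon>"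
      by eventually_elim (simp add: seminorm_nonneg[OF p])
  qed
next
  assume *: "\<forall>p\<in>P. ((\<lambda>x. p (f x - l)) \<longlongrightarrow> 0) F"
  show "(f \<longlongrightarrow> l) F"
  proof (rule topological_tendstoI)
    fix U assume "open U" "l \<in> U"
    then obtain p \<epsilon> where p: "p \<in> P" "\<epsilon> > 0" "{y. p (y - l) < \<epsilon>} \<subseteq> U"
      unfolding open_iff by blast
    have "\<forall>\<^sub>F x in F. dist (p (f x - l)) 0 < \<epsilon>"
      using * p(1,2) tendstoD by blast
    then show "\<forall>\<^sub>F x in F. f x \<in> U"
      by eventually_elim (use p(3) in auto)
  qed
qed

lemma locally_Holder_seminorm_tendsto:
  assumes "open \<Omega>" "0 < \<gamma>" "locally_Holder P \<gamma> \<Omega> f" "x \<in> \<Omega>" "p \<in> P"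
  shows "((\<lambda>y. p (f y - f x)) \<longlongrightarrow> 0) (at x)"
proof -
  obtain r where r: "r > 0" "cball x r \<subseteq> \<Omega>"
    using assms(1,4) open_contains_cball by blast
  then obtain C where C: "\<forall>y\<in>cball x r. \<forall>z\<in>cball x r. p (f y - f z) \<le> C * norm (y - z) powr \<gamma>"
    using assms(3,5) compact_cball[of x r] unfolding locally_Holder_def by blast
  show ?thesis
  proof (rule tendsto_sandwich[where f = "\<lambda>_. 0"])
    have "((\<lambda>y. C * norm (y - x) powr \<gamma>) \<longlongrightarrow> C * norm (x - x) powr \<gamma>) (at x)"
      using assms(2) by (intro tendsto_intros tendsto_powr') auto
    then show "((\<lambda>y. C * norm (y - x) powr \<gamma>) \<longlongrightarrow> 0) (at x)" by simp
    have "\<forall>\<^sub>F y in at x. y \<in> cball x r"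
      using r(1) by (auto simp: eventually_at dist_commute less_imp_le)
    then show "\<forall>\<^sub>F y in at x. p (f y - f x) \<le> C * norm (y - x) powr \<gamma>"
      by eventually_elim (use C r(1) in auto)
  qed (auto simp: seminorm_nonneg[OF assms(5)])
qed

lemma locally_Holder_imp_continuous_on:
  assumes "open \<Omega>" "0 < \<gamma>" "locally_Holder P \<gamma> \<Omega> f"
  shows "continuous_on \<Omega> f"
proof -
  have "(f \<longlongrightarrow> f x) (at x)" if "x \<in> \<Omega>" for x
    unfolding tendsto_iff_seminorms using locally_Holder_seminorm_tendsto[OF assms that] by blast
  then show ?thesis
    by (simp add: continuous_at_imp_continuous_on isCont_def)
qed

lemma locally_Holder_imp_bounded:
  assumes "0 < \<gamma>" "locally_Holder P \<gamma> \<Omega> f" "compact K" "K \<subseteq> \<Omega>" "p \<in> P"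
  shows "bdd_above ((\<lambda>x. p (f x)) ` K)"
proof (cases "K = {}")
  case False
  then obtain x where x: "x \<in> K" by blast
  obtain C where C: "\<forall>y\<in>K. \<forall>z\<in>K. p (f y - f z) \<le> C * norm (y - z) powr \<gamma>"
    using assms(2-5) unfolding locally_Holder_def by blast
  have "p (f y) \<le> p (f x) + \<bar>C\<bar> * diameter K powr \<gamma>" if "y \<in> K" for y
  proof -
    have "p (f y) \<le> p (f y - f x) + p (f x)"
      using seminorm_triangle[OF assms(5), of "f y - f x" "f x"] by simp
    also have "p (f y - f x) \<le> C * norm (y - x) powr \<gamma>"
      using C that x by blast
    \<comment> \<open>\<open>C\<close> may be negative, so its absolute value is taken before the
      distance is enlarged to the diameter.\<close>
    also have "\<dots> \<le> \<bar>C\<bar> * norm (y - x) powr \<gamma>"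
      by (intro mult_right_mono) auto
    also have "\<dots> \<le> \<bar>C\<bar> * diameter K powr \<gamma>"
      using assms(1) diameter_bounded_bound[OF compact_imp_bounded[OF assms(3)] that x]
      by (intro mult_left_mono powr_mono2) (auto simp: dist_norm)
    finally show ?thesis by simp
  qed
  then show ?thesis by (auto intro!: bdd_aboveI2)
qed simp

lemma iterated_Holder_imp_cont_partially_diff:
  assumes "open \<Omega>" "0 < \<gamma>" "iterated_Holder smul P k \<gamma> \<Omega> f"
  shows "cont_partially_diff smul k \<Omega> f"
  using assms(3)
proof (induction k arbitrary: f)
  case 0
  then have "locally_Holder P \<gamma> \<Omega> (foldr (partial_deriv smul) [] f)"
    unfolding iterated_Holder_def by blast
  then show ?case
    using locally_Holder_imp_continuous_on[OF assms(1,2)] by simp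
next
  case (Suc k)
  have hol: "locally_Holder P \<gamma> \<Omega> (foldr (partial_deriv smul) is f)" if "length is \<le> Suc k" for "is"
    using Suc.prems that unfolding iterated_Holder_def by blast
  have diff: "has_partial_deriv smul i (foldr (partial_deriv smul) is f) x"
    if "length is < Suc k" "x \<in> \<Omega>" for "is" i x
    using Suc.prems that unfolding iterated_Holder_def by blast
  \<comment> \<open>A word ending in \<open>i\<close> differentiates along \<open>i\<close> first,
    so the conditions on \<open>f\<close> for words \<open>is @ [i]\<close> are those on its partial
    derivative for \<open>is\<close>.\<close>
  have "iterated_Holder smul P k \<gamma> \<Omega> (partial_deriv smul i f)" for i
    unfolding iterated_Holder_def using hol[of "_ @ [i]"] diff[of "_ @ [i]"] by simp
  then show ?case
    using Suc.IH hol[of "[]"] diff[of "[]"] locally_Holder_imp_continuous_on[OF assms(1,2)] by simp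
qed

lemma iterated_Holder_imp_C_loc_space:
  fixes f :: "(real, 'd::{finite,linorder}) vec \<Rightarrow> 'e"
  assumes "open \<Omega>" "0 < \<gamma>" "iterated_Holder smul P k \<gamma> \<Omega> f"
  shows "f \<in> C_loc_space smul P k \<gamma> \<Omega>"
proof -
  have hol: "locally_Holder P \<gamma> \<Omega> (multi_deriv smul \<beta> f)" if "(\<Sum>i\<in>UNIV. \<beta> i) \<le> k" for \<beta>
    using assms(3) that by (simp add: iterated_Holder_def multi_deriv_eq_foldr length_multi_index_list)
  have quot: "bdd_above {p (multi_deriv smul \<beta> f x - multi_deriv smul \<beta> f y) / norm (x - y) powr \<gamma> | x y.
        x \<in> K \<and> y \<in> K \<and> x \<noteq> y}"
    if K: "compact K" "K \<subseteq> \<Omega>" "p \<in> P" "(\<Sum>i\<in>UNIV. \<beta> i) = k" for K p \<beta>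
  proof -
    obtain C where C: "\<forall>x\<in>K. \<forall>y\<in>K. p (multi_deriv smul \<beta> f x - multi_deriv smul \<beta> f y)
        \<le> C * norm (x - y) powr \<gamma>"
      using hol[of \<beta>] K unfolding locally_Holder_def by blast
    then show ?thesis
      by (intro bdd_aboveI[of _ C]) (auto simp: pos_divide_le_eq)
  qed
  have bdd: "bdd_above ((\<lambda>x. p (multi_deriv smul \<beta> f x)) ` K)"
    if "compact K" "K \<subseteq> \<Omega>" "p \<in> P" "(\<Sum>i\<in>UNIV. \<beta> i) \<le> k" for K p \<beta>
    using locally_Holder_imp_bounded[OF assms(2) hol[OF that(4)] that(1-3)] .
  have Ck: "f \<in> C_space smul k \<Omega>"
    using iterated_Holder_imp_cont_partially_diff[OF assms] by (simp add: C_space_def)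
  show ?thesis
    unfolding C_loc_space_def mem_Collect_eq by (intro conjI allI impI Ck bdd quot)
qed

end


section \<open>Closed bounded discs and convergence under local completeness\<close>

section \<open>Local completeness\<close>

context lcs
begin

context
  fixes M :: "('e \<Rightarrow> real) \<Rightarrow> real" and D
  assumes M_pos: "\<And>p. p \<in> P \<Longrightarrow> 0 < M p"
  defines "D \<equiv> {x. \<forall>p\<in>P. p x \<le> M p}"
begin

lemma polar_disc_closed: "closed D"
proof -
  have "open {x. M p < p x}" if p: "p \<in> P" for p
    unfolding open_iff
  proof safe
    fix x assume x: "M p < p x"
    have "{y. p (y - x) < p x - M p} \<subseteq> {y. M p < p y}"
    proof safe
      fix y assume "p (y - x) < p x - M p"
      then show "M p < p y"
        using seminorm_triangle[OF p, of "x - y" y] seminorm_diff_commute[OF p, of x y] by simp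
    qed
    then show "\<exists>q\<in>P. \<exists>\<epsilon>>0. {y. q (y - x) < \<epsilon>} \<subseteq> {x. M p < p x}"
      using p x by (intro bexI[of _ p] exI[of _ "p x - M p"]) auto
  qed
  then have "open (\<Union>p\<in>P. {x. M p < p x})" by blast
  moreover have "- D = (\<Union>p\<in>P. {x. M p < p x})" by (auto simp: D_def not_le)
  ultimately show ?thesis by (simp add: closed_def)
qed

lemma polar_disc_bounded: "bounded_wrt P D"
  unfolding bounded_wrt_def by (auto simp: D_def intro!: bdd_aboveI2)

lemma polar_disc_absolutely_convex: "absolutely_convex smul D"
  unfolding absolutely_convex_def
proof (intro conjI ballI allI impI)
  have "0 \<in> D" using M_pos by (auto simp: D_def seminorm_zero less_imp_le)
  then show "D \<noteq> {}" by blast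
  fix x y and a b :: 'k assume xy: "x \<in> D" "y \<in> D" and ab: "norm a + norm b \<le> 1"
  show "smul a x + smul b y \<in> D"
    unfolding D_def
  proof safe
    fix p assume p: "p \<in> P"
    have "p (smul a x + smul b y) \<le> norm a * p x + norm b * p y"
      using seminorm_triangle[OF p, of "smul a x" "smul b y"] by (simp add: seminorm_smul[OF p])
    also have "\<dots> \<le> norm a * M p + norm b * M p"
      using xy p by (intro add_mono mult_left_mono) (auto simp: D_def)
    also have "\<dots> = (norm a + norm b) * M p" by (simp add: algebra_simps)
    also have "\<dots> \<le> 1 * M p"
      using ab M_pos[OF p] by (intro mult_right_mono) auto
    finally show "p (smul a x + smul b y) \<le> M p" by simp
  qed
qed

text \<open>Homogeneity describes dilates of \<open>D\<close> by seminorms, so on its span the gauge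
  is the supremum of \<open>p x / M p\<close>; \<open>disc_gauge_le\<close> and
  \<open>seminorm_le_disc_gauge\<close> are the two halves of this.\<close>

lemma mem_smul_polar_disc_iff:
  assumes "t > 0"
  shows "x \<in> smul (of_real t) ` D \<longleftrightarrow> (\<forall>p\<in>P. p x \<le> t * M p)"
proof safe
  fix p d assume "d \<in> D" "p \<in> P"
  then show "p (smul (of_real t) d) \<le> t * M p"
    using assms by (simp add: seminorm_smul D_def)
next
  assume *: "\<forall>p\<in>P. p x \<le> t * M p"
  have "smul (of_real (1 / t)) x \<in> D"
    unfolding D_def
  proof safe
    fix p assume p: "p \<in> P"
    have "p (smul (of_real (1 / t)) x) = p x / t"
      using assms by (simp add: seminorm_smul[OF p] del: of_real_divide)
    then show "p (smul (of_real (1 / t)) x) \<le> M p"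
      using * p assms by (simp add: pos_divide_le_eq mult.commute)
  qed
  moreover have "x = smul (of_real t) (smul (of_real (1 / t)) x)"
    using assms by simp
  ultimately show "x \<in> smul (of_real t) ` D" by (rule rev_image_eqI)
qed

lemma disc_gauge_le:
  assumes "t > 0" "\<And>p. p \<in> P \<Longrightarrow> p x \<le> t * M p"
  shows "disc_gauge smul D x \<le> t"
  unfolding disc_gauge_def using assms mem_smul_polar_disc_iff
  by (intro cInf_lower bdd_belowI[of _ 0]) auto

lemma mem_disc_span:
  assumes "\<And>p. p \<in> P \<Longrightarrow> p x \<le> t * M p"
  shows "x \<in> disc_span smul D"
proof -
  obtain m :: nat where "t \<le> m"
    using real_arch_simple by blast
  \<comment> \<open>The span is made of natural multiples, and \<open>Suc m\<close> makes the
    multiple positive even if \<open>m = 0\<close>.\<close>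
  then obtain n :: nat where n: "t \<le> n" "0 < n"
    using that[of "Suc m"] by simp
  have "p x \<le> n * M p" if "p \<in> P" for p
    using assms[OF that] mult_right_mono[OF n(1), of "M p"] M_pos[OF that] by linarith
  then have "x \<in> smul (of_real n) ` D"
    using n(2) mem_smul_polar_disc_iff[of n] by simp
  then show ?thesis unfolding disc_span_def by auto
qed

lemma seminorm_le_disc_gauge:
  assumes "x \<in> disc_span smul D" "p \<in> P"
  shows "p x \<le> disc_gauge smul D x * M p"
proof -
  \<comment> \<open>\<open>cInf_greatest\<close> needs a nonempty set. The multiple \<open>n\<close>
    taken from the span may be \<open>0\<close>, so \<open>Suc n\<close> serves as the positive
    dilation factor.\<close>
  have "{t. 0 < t \<and> x \<in> smul (of_real t) ` D} \<noteq> {}"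
  proof -
    obtain n d where d: "d \<in> D" "x = smul (of_nat n) d"
      using assms(1) unfolding disc_span_def by blast
    have "q x \<le> real (Suc n) * M q" if q: "q \<in> P" for q
    proof -
      have "q x = real n * q d"
        using d(2) by (simp add: seminorm_smul[OF q])
      also have "\<dots> \<le> real (Suc n) * M q"
        using d(1) q by (intro mult_mono) (auto simp: D_def seminorm_nonneg)
      finally show ?thesis .
    qed
    then have "x \<in> smul (of_real (real (Suc n))) ` D"
      by (subst mem_smul_polar_disc_iff) auto
    then show ?thesis using of_nat_0_less_iff by blast
  qed
  then have "p x / M p \<le> disc_gauge smul D x"
    unfolding disc_gauge_def
    using assms(2) M_pos[OF assms(2)] mem_smul_polar_disc_iff
    by (intro cInf_greatest) (auto simp: pos_divide_le_eq)
  then show ?thesis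
    using M_pos[OF assms(2)] by (simp add: pos_divide_le_eq)
qed

end

text \<open>The differences of the sequence tend to \<open>0\<close> with a rate that is uniform in the seminorms,
  so the sequence is Cauchy with respect to the gauge of a single disc.\<close>

lemma locally_complete_convergent:
  fixes X :: "nat \<Rightarrow> 'e"
  assumes "locally_complete smul P"
    and M: "\<And>p. p \<in> P \<Longrightarrow> 0 < M p" and r: "\<And>n. 0 < r n" "r \<longlonglongrightarrow> 0"
    and X: "\<And>p m n. p \<in> P \<Longrightarrow> p (X m - X n) \<le> (r m + r n) * M p"
  shows "\<exists>l. X \<longlonglongrightarrow> l"
proof -
  define D where "D = {x. \<forall>p\<in>P. p x \<le> M p}"
  have "closed D" "bounded_wrt P D" "absolutely_convex smul D"
    unfolding D_def
    by (rule polar_disc_closed polar_disc_bounded polar_disc_absolutely_convex; rule M; assumption)+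
  then have banach: "banach_space_on smul (disc_span smul D) (disc_gauge smul D)"
    using assms(1) by (simp add: locally_complete_def)
  have sub: "subspace (disc_span smul D)"
    using banach by (simp add: banach_space_on_def)
  have complete: "\<forall>Y :: nat \<Rightarrow> 'e. range Y \<subseteq> disc_span smul D \<longrightarrow>
      (\<forall>\<epsilon>>0. \<exists>N. \<forall>m\<ge>N. \<forall>n\<ge>N. disc_gauge smul D (Y m - Y n) < \<epsilon>) \<longrightarrow>
      (\<exists>x\<in>disc_span smul D. (\<lambda>n. disc_gauge smul D (Y n - x)) \<longlonglongrightarrow> 0)"
    using banach unfolding banach_space_on_def by (elim conjE)
  \<comment> \<open>Only differences of \<open>X\<close> are controlled, so the sequence is shifted
    by \<open>X 0\<close> into the span of \<open>D\<close>.\<close>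
  define Y where "Y n = X n - X 0" for n
  have Y: "Y n \<in> disc_span smul D" for n
    unfolding D_def Y_def by (rule mem_disc_span[OF M X])
  have cauchy: "\<exists>N. \<forall>m\<ge>N. \<forall>n\<ge>N. disc_gauge smul D (Y m - Y n) < \<epsilon>" if eps: "\<epsilon> > 0" for \<epsilon>
  proof -
    obtain N where N: "\<And>n. n \<ge> N \<Longrightarrow> r n < \<epsilon> / 2"
      using order_tendstoD(2)[OF r(2) half_gt_zero[OF eps]] unfolding eventually_sequentially by auto
    have "disc_gauge smul D (Y m - Y n) < \<epsilon>" if "m \<ge> N" "n \<ge> N" for m n
    proof -
      have "disc_gauge smul D (Y m - Y n) \<le> r m + r n"
        unfolding D_def Y_def using X r(1) by (intro disc_gauge_le[OF M]) (auto intro: add_pos_pos)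
      then show ?thesis using N[OF that(1)] N[OF that(2)] by simp
    qed
    then show ?thesis by blast
  qed
  then obtain x where x: "x \<in> disc_span smul D" "(\<lambda>n. disc_gauge smul D (Y n - x)) \<longlonglongrightarrow> 0"
    using complete[rule_format, of Y] cauchy Y by (metis image_subsetI)
  \<comment> \<open>Convergence in the gauge of \<open>D\<close> implies convergence in each
    seminorm.\<close>
  have "X \<longlonglongrightarrow> x + X 0"
    unfolding tendsto_iff_seminorms
  proof
    fix p assume p: "p \<in> P"
    show "(\<lambda>n. p (X n - (x + X 0))) \<longlonglongrightarrow> 0"
    proof (rule tendsto_sandwich[where f = "\<lambda>_. 0"])
      show "(\<lambda>n. disc_gauge smul D (Y n - x) * M p) \<longlonglongrightarrow> 0"
        using tendsto_mult_right[OF x(2), of "M p"] by simp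
      have "p (X n - (x + X 0)) \<le> disc_gauge smul D (Y n - x) * M p" for n
      proof -
        have "p (Y n - x) \<le> disc_gauge smul D (Y n - x) * M p"
          unfolding D_def
          by (rule seminorm_le_disc_gauge[where M = M, OF _ subspace_diff[OF sub Y x(1), unfolded D_def] p])
             (rule M)
        then show ?thesis by (simp add: Y_def diff_diff_eq add.commute)
      qed
      then show "\<forall>\<^sub>F n in sequentially. p (X n - (x + X 0)) \<le> disc_gauge smul D (Y n - x) * M p"
        by simp
    qed (auto simp: seminorm_nonneg[OF p])
  qed
  then show ?thesis ..
qed

text \<open>Along one null sequence a limit \<open>l\<close> exists by
  \<open>locally_complete_convergent\<close>. Letting \<open>h'\<close> run through that sequence in
  the Cauchy estimate bounds \<open>p (f h - l)\<close> for all small nonzero \<open>h\<close>,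
  hence the full limit.\<close>

lemma locally_complete_tendsto_at_0:
  fixes f :: "real \<Rightarrow> 'e"
  assumes "locally_complete smul P" and M: "\<And>p. p \<in> P \<Longrightarrow> 0 < M p" and "0 < \<gamma>" "0 < r"
    and f: "\<And>p h h'. p \<in> P \<Longrightarrow> 0 < \<bar>h\<bar> \<Longrightarrow> \<bar>h\<bar> \<le> r \<Longrightarrow> 0 < \<bar>h'\<bar> \<Longrightarrow> \<bar>h'\<bar> \<le> r \<Longrightarrow>
          p (f h - f h') \<le> (\<bar>h\<bar> powr \<gamma> + \<bar>h'\<bar> powr \<gamma>) * M p"
  shows "\<exists>l. (f \<longlongrightarrow> l) (at 0)"
proof -
  \<comment> \<open>A null sequence of nonzero points within radius \<open>r\<close>, already from
    \<open>n = 0\<close> on.\<close>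
  define a where "a n = r * inverse (real (Suc n))" for n
  have a: "0 < \<bar>a n\<bar>" "\<bar>a n\<bar> \<le> r" for n
    using assms(4) by (auto simp: a_def field_simps)
  have "a \<longlonglongrightarrow> r * 0"
    unfolding a_def by (intro tendsto_mult tendsto_const LIMSEQ_inverse_real_of_nat)
  then have "(\<lambda>n. \<bar>a n\<bar> powr \<gamma>) \<longlonglongrightarrow> \<bar>r * 0\<bar> powr \<gamma>"
    using assms(3) by (intro tendsto_powr' tendsto_rabs tendsto_const) auto
  then have a0: "(\<lambda>n. \<bar>a n\<bar> powr \<gamma>) \<longlonglongrightarrow> 0" by simp
  have "\<exists>l. (\<lambda>n. f (a n)) \<longlonglongrightarrow> l"
  proof (rule locally_complete_convergent[OF assms(1) _ _ a0])
    show "p (f (a m) - f (a n)) \<le> (\<bar>a m\<bar> powr \<gamma> + \<bar>a n\<bar> powr \<gamma>) * M p" if "p \<in> P" for p m n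
      using f[OF that a a] .
    show "0 < \<bar>a n\<bar> powr \<gamma>" for n
      using a(1)[of n] by simp
  qed (rule M)
  then obtain l where l: "(\<lambda>n. f (a n)) \<longlonglongrightarrow> l" ..
  have "(f \<longlongrightarrow> l) (at 0)"
    unfolding tendsto_iff_seminorms
  proof
    fix p assume p: "p \<in> P"
    have bound: "p (f h - l) \<le> \<bar>h\<bar> powr \<gamma> * M p" if h: "0 < \<bar>h\<bar>" "\<bar>h\<bar> \<le> r" for h
    proof (rule tendsto_lowerbound)
      have "(\<lambda>n. (\<bar>h\<bar> powr \<gamma> + \<bar>a n\<bar> powr \<gamma>) * M p + p (f (a n) - l))
          \<longlonglongrightarrow> (\<bar>h\<bar> powr \<gamma> + 0) * M p + 0"
        using l p unfolding tendsto_iff_seminorms by (intro tendsto_intros a0) auto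
      then show "(\<lambda>n. (\<bar>h\<bar> powr \<gamma> + \<bar>a n\<bar> powr \<gamma>) * M p + p (f (a n) - l))
          \<longlonglongrightarrow> \<bar>h\<bar> powr \<gamma> * M p" by simp
      show "\<forall>\<^sub>F n in sequentially. p (f h - l) \<le> (\<bar>h\<bar> powr \<gamma> + \<bar>a n\<bar> powr \<gamma>) * M p + p (f (a n) - l)"
      proof (intro always_eventually allI)
        fix n
        show "p (f h - l) \<le> (\<bar>h\<bar> powr \<gamma> + \<bar>a n\<bar> powr \<gamma>) * M p + p (f (a n) - l)"
          using f[OF p h a[of n]] seminorm_diff_triangle[OF p, of "f h" l "f (a n)"] by simp
      qed
    qed simp
    show "((\<lambda>h. p (f h - l)) \<longlongrightarrow> 0) (at 0)"
    proof (rule tendsto_sandwich[where f = "\<lambda>_. 0"])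
      have "((\<lambda>h. \<bar>h\<bar> powr \<gamma> * M p) \<longlongrightarrow> \<bar>0\<bar> powr \<gamma> * M p) (at 0)"
        using assms(3) by (intro tendsto_mult tendsto_powr' tendsto_rabs tendsto_ident_at tendsto_const) auto
      then show "((\<lambda>h. \<bar>h\<bar> powr \<gamma> * M p) \<longlongrightarrow> 0) (at 0)" by simp
      show "\<forall>\<^sub>F h in at 0. p (f h - l) \<le> \<bar>h\<bar> powr \<gamma> * M p"
        unfolding eventually_at using assms(4) bound by (intro exI[of _ r]) auto
    qed (auto simp: seminorm_nonneg[OF p])
  qed
  then show ?thesis ..
qed

end


section \<open>Transfer of regularity from the functionals in \<open>G\<close> to the space\<close>

section \<open>Weak criteria\<close>

locale boundedness_determining = lcs smul P
  for smul :: "'k::real_normed_field \<Rightarrow> 'e::{ab_group_add,t2_space} \<Rightarrow> 'e" and P +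
  fixes G :: "('e \<Rightarrow> 'k) set"
  assumes subdual: "dual_subspace smul G" and determines: "determines_boundedness P G"
begin

context
  fixes \<phi> assumes \<phi>: "\<phi> \<in> G"
begin

lemma functional_diff: "\<phi> (x - y) = \<phi> x - \<phi> y"
  and functional_smul: "\<phi> (smul c x) = c * \<phi> x"
proof -
  have "Vector_Spaces.linear smul (*) \<phi>"
    using \<phi> subdual by (auto simp: dual_subspace_def dual_space_def)
  then interpret Vector_Spaces.linear smul "(*)" \<phi> .
  show "\<phi> (x - y) = \<phi> x - \<phi> y" "\<phi> (smul c x) = c * \<phi> x"
    by (rule diff, rule scale)
qed

lemma functional_tendsto: "(f \<longlongrightarrow> l) F \<Longrightarrow> ((\<lambda>x. \<phi> (f x)) \<longlongrightarrow> \<phi> l) F"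
proof -
  have "continuous_on UNIV \<phi>"
    using \<phi> subdual by (auto simp: dual_subspace_def dual_space_def)
  then show "(f \<longlongrightarrow> l) F \<Longrightarrow> ((\<lambda>x. \<phi> (f x)) \<longlongrightarrow> \<phi> l) F"
    by (simp add: continuous_on_eq_continuous_at isCont_tendsto_compose)
qed

lemma diff_quot_functional: "diff_quot (*) i (\<phi> \<circ> f) x h = \<phi> (diff_quot smul i f x h)"
  by (simp add: diff_quot_def functional_diff functional_smul)

text \<open>Continuous linear functionals commute with difference quotients and with their
  limits.\<close>

lemma partial_deriv_functional:
  assumes "has_partial_deriv smul i f x"
  shows "partial_deriv (*) i (\<phi> \<circ> f) x = \<phi> (partial_deriv smul i f x)"
  using functional_tendsto[OF has_partial_deriv_tendsto[OF assms]]
  by (intro partial_deriv_unique) (simp add: diff_quot_functional[abs_def])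

end

text \<open>The constants may vary freely with \<open>\<phi>\<close>. The bound for \<open>p\<close>
  is made positive because such bounds later define a disc.\<close>

lemma weakly_bounded_imp_bounded:
  assumes "\<And>\<phi>. \<phi> \<in> G \<Longrightarrow> \<exists>C. \<forall>b\<in>B. norm (\<phi> b) \<le> C" "p \<in> P"
  shows "\<exists>C>0. \<forall>b\<in>B. p b \<le> C"
proof -
  have "bounded_wrt (weak_seminorms G) B"
    unfolding bounded_wrt_def weak_seminorms_def using assms(1) by (auto simp: bdd_above_def)
  then have "bounded_wrt P B"
    using determines by (simp add: determines_boundedness_def)
  then have "bdd_above (p ` B)"
    using assms(2) by (simp add: bounded_wrt_def)
  then obtain C where "\<forall>b\<in>B. p b \<le> C"
    by (auto simp: bdd_above_def)
  then have "\<forall>b\<in>B. p b \<le> max C 1" by (auto simp: le_max_iff_disj)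
  then show ?thesis by (intro exI[of _ "max C 1"]) simp
qed

lemma weak_locally_Holder:
  assumes "\<And>\<phi>. \<phi> \<in> G \<Longrightarrow> locally_Holder {norm} \<gamma> \<Omega> (\<phi> \<circ> f)"
  shows "locally_Holder P \<gamma> \<Omega> f"
  unfolding locally_Holder_def
proof (intro allI impI)
  fix K p assume K: "compact K" "K \<subseteq> \<Omega>" and p: "p \<in> P"
  \<comment> \<open>The Hoelder quotient as an element of the space, with the real factor embedded
    into the scalar field.\<close>
  define q where "q x y = smul (of_real (inverse (norm (x - y) powr \<gamma>))) (f x - f y)" for x y
  have "\<exists>C>0. \<forall>b\<in>{q x y | x y. x \<in> K \<and> y \<in> K \<and> x \<noteq> y}. p b \<le> C"
  proof (rule weakly_bounded_imp_bounded[OF _ p])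
    fix \<phi> assume \<phi>: "\<phi> \<in> G"
    obtain C where C: "\<forall>x\<in>K. \<forall>y\<in>K. norm ((\<phi> \<circ> f) x - (\<phi> \<circ> f) y) \<le> C * norm (x - y) powr \<gamma>"
      using assms[OF \<phi>] K unfolding locally_Holder_def by blast
    have "norm (\<phi> (q x y)) \<le> C" if "x \<in> K" "y \<in> K" "x \<noteq> y" for x y
    proof -
      have "norm (\<phi> (q x y)) = norm (\<phi> (f x) - \<phi> (f y)) / norm (x - y) powr \<gamma>"
        unfolding q_def functional_smul[OF \<phi>] functional_diff[OF \<phi>] norm_mult norm_of_real
        by (simp add: divide_simps)
      then show ?thesis
        using C that by (simp add: pos_divide_le_eq)
    qed
    then show "\<exists>C. \<forall>b\<in>{q x y | x y. x \<in> K \<and> y \<in> K \<and> x \<noteq> y}. norm (\<phi> b) \<le> C"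
      by blast
  qed
  then obtain C where C: "\<And>x y. x \<in> K \<Longrightarrow> y \<in> K \<Longrightarrow> x \<noteq> y \<Longrightarrow> p (q x y) \<le> C"
    by blast
  have "p (f x - f y) \<le> C * norm (x - y) powr \<gamma>" if "x \<in> K" "y \<in> K" for x y
  proof (cases "x = y")
    case False
    have "p (q x y) = p (f x - f y) / norm (x - y) powr \<gamma>"
      unfolding q_def seminorm_smul[OF p] norm_of_real by (simp add: divide_simps)
    then show ?thesis
      using C[OF that False] False by (simp add: pos_divide_le_eq)
  qed (simp add: seminorm_zero[OF p])
  then show "\<exists>C. \<forall>x\<in>K. \<forall>y\<in>K. p (f x - f y) \<le> C * norm (x - y) powr \<gamma>"
    by blast
qed

text \<open>By the mean value inequality, \<open>\<phi>\<close> of the difference quotient converges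
  at rate \<open>\<bar>h\<bar> powr \<gamma>\<close>, with a constant depending on
  \<open>\<phi>\<close>. Subtracting two quotients removes the limit, whose counterpart in the space
  is not yet known to exist.\<close>

lemma weak_has_partial_deriv:
  fixes f :: "real^'d::finite \<Rightarrow> 'e"
  assumes "locally_complete smul P" "open \<Omega>" "x \<in> \<Omega>" "0 < \<gamma>"
    and diff: "\<And>\<phi> y. \<phi> \<in> G \<Longrightarrow> y \<in> \<Omega> \<Longrightarrow> has_partial_deriv (*) i (\<phi> \<circ> f) y"
    and hol: "\<And>\<phi>. \<phi> \<in> G \<Longrightarrow> locally_Holder {norm} \<gamma> \<Omega> (partial_deriv (*) i (\<phi> \<circ> f))"
  shows "has_partial_deriv smul i f x"
proof -
  obtain r where r: "r > 0" "cball x r \<subseteq> \<Omega>"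
    using assms(2,3) open_contains_cball by blast
  define d where "d = diff_quot smul i f x"
  have rate: "\<exists>C\<ge>0. \<forall>h. 0 < \<bar>h\<bar> \<and> \<bar>h\<bar> \<le> r \<longrightarrow> norm (\<phi> (d h) - partial_deriv (*) i (\<phi> \<circ> f) x) \<le> C * \<bar>h\<bar> powr \<gamma>"
    if \<phi>: "\<phi> \<in> G" for \<phi>
  proof -
    define g where "g = \<phi> \<circ> f"
    obtain C' where C': "\<forall>y\<in>cball x r. \<forall>z\<in>cball x r.
        norm (partial_deriv (*) i g y - partial_deriv (*) i g z) \<le> C' * norm (y - z) powr \<gamma>"
      using hol[OF \<phi>] r(2) compact_cball[of x r] unfolding locally_Holder_def g_def by blast
    define C where "C = \<bar>C'\<bar>"
    have "norm (\<phi> (d h) - partial_deriv (*) i g x) \<le> C * \<bar>h\<bar> powr \<gamma>" if h: "0 < \<bar>h\<bar>" "\<bar>h\<bar> \<le> r" for h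
    proof -
      have "norm (g (x + h *\<^sub>R axis i 1) - g x - h *\<^sub>R partial_deriv (*) i g x) \<le> C * \<bar>h\<bar> powr \<gamma> * \<bar>h\<bar>"
      proof (rule axis_mean_value)
        fix s assume s: "s \<in> closed_segment 0 h"
        have "\<bar>s\<bar> \<le> \<bar>h\<bar>" using closed_segment_zero_abs_le[OF s] .
        then have mem: "x + s *\<^sub>R axis i 1 \<in> cball x r"
          using h by (simp add: dist_norm)
        then show "has_partial_deriv (*) i g (x + s *\<^sub>R axis i 1)"
          unfolding g_def using diff[OF \<phi>] r(2) by blast
        have "norm (partial_deriv (*) i g (x + s *\<^sub>R axis i 1) - partial_deriv (*) i g x) \<le> C' * \<bar>s\<bar> powr \<gamma>"
          using C'[rule_format, OF mem, of x] r(1) by simp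
        also have "\<dots> \<le> C * \<bar>h\<bar> powr \<gamma>"
          using \<open>\<bar>s\<bar> \<le> \<bar>h\<bar>\<close> assms(4) by (intro mult_mono powr_mono2) (auto simp: C_def)
        finally show "norm (partial_deriv (*) i g (x + s *\<^sub>R axis i 1) - partial_deriv (*) i g x) \<le> C * \<bar>h\<bar> powr \<gamma>" .
      qed
      moreover have "\<phi> (d h) - partial_deriv (*) i g x
          = (1 / h) *\<^sub>R (g (x + h *\<^sub>R axis i 1) - g x - h *\<^sub>R partial_deriv (*) i g x)"
        using h unfolding d_def diff_quot_functional[OF \<phi>, symmetric] g_def[symmetric]
        by (simp add: diff_quot_def scaleR_conv_of_real[where 'a='k] algebra_simps)
      ultimately show ?thesis
        using h by (simp add: pos_divide_le_eq)
    qed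
    then show ?thesis by (auto simp: g_def C_def intro!: exI[of _ C])
  qed
  define q where "q h h' = smul (of_real (inverse (\<bar>h\<bar> powr \<gamma> + \<bar>h'\<bar> powr \<gamma>))) (d h - d h')" for h h'
  have pos: "0 < \<bar>h\<bar> powr \<gamma> + \<bar>h'\<bar> powr \<gamma>" if "0 < \<bar>h\<bar>" for h h'
    using that by (intro add_pos_nonneg) auto
  define B where "B = {q h h' | h h'. 0 < \<bar>h\<bar> \<and> \<bar>h\<bar> \<le> r \<and> 0 < \<bar>h'\<bar> \<and> \<bar>h'\<bar> \<le> r}"
  have bdd: "\<exists>C>0. \<forall>b\<in>B. p b \<le> C" if p: "p \<in> P" for p
  proof (rule weakly_bounded_imp_bounded[OF _ p])
    fix \<phi> assume \<phi>: "\<phi> \<in> G"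
    obtain C where C: "\<And>h. 0 < \<bar>h\<bar> \<Longrightarrow> \<bar>h\<bar> \<le> r \<Longrightarrow>
        norm (\<phi> (d h) - partial_deriv (*) i (\<phi> \<circ> f) x) \<le> C * \<bar>h\<bar> powr \<gamma>"
      using rate[OF \<phi>] by blast
    have "norm (\<phi> (q h h')) \<le> C"
      if h: "0 < \<bar>h\<bar>" "\<bar>h\<bar> \<le> r" and h': "0 < \<bar>h'\<bar>" "\<bar>h'\<bar> \<le> r" for h h'
    proof -
      \<comment> \<open>The scalar derivative at \<open>x\<close> is the intermediate point of the
        triangle inequality and drops out.\<close>
      have "norm (\<phi> (d h) - \<phi> (d h')) \<le> C * \<bar>h\<bar> powr \<gamma> + C * \<bar>h'\<bar> powr \<gamma>"
        using C[OF h] C[OF h'] norm_triangle_ineq4[of "\<phi> (d h) - partial_deriv (*) i (\<phi> \<circ> f) x"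
            "\<phi> (d h') - partial_deriv (*) i (\<phi> \<circ> f) x"] by simp
      moreover have "norm (\<phi> (q h h')) = norm (\<phi> (d h) - \<phi> (d h')) / (\<bar>h\<bar> powr \<gamma> + \<bar>h'\<bar> powr \<gamma>)"
        unfolding q_def functional_smul[OF \<phi>] functional_diff[OF \<phi>] norm_mult norm_of_real
        using pos[OF h(1), of h'] by (simp add: divide_simps)
      ultimately show ?thesis
        using pos[OF h(1), of h'] by (simp add: pos_divide_le_eq algebra_simps)
    qed
    then show "\<exists>C. \<forall>b\<in>B. norm (\<phi> b) \<le> C"
      unfolding B_def by blast
  qed
  \<comment> \<open>One positive bound per seminorm is chosen; together they define the disc, while
    the rate in \<open>h\<close> and \<open>h'\<close> is common to all seminorms.\<close>
  have "\<exists>M. \<forall>p\<in>P. M p > 0 \<and> (\<forall>b\<in>B. p b \<le> M p)"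
    by (rule bchoice) (use bdd in blast)
  then obtain M where M: "\<And>p. p \<in> P \<Longrightarrow> 0 < M p" "\<And>p b. p \<in> P \<Longrightarrow> b \<in> B \<Longrightarrow> p b \<le> M p"
    by blast
  have *: "p (d h - d h') \<le> (\<bar>h\<bar> powr \<gamma> + \<bar>h'\<bar> powr \<gamma>) * M p"
    if p: "p \<in> P" and h: "0 < \<bar>h\<bar>" "\<bar>h\<bar> \<le> r" "0 < \<bar>h'\<bar>" "\<bar>h'\<bar> \<le> r" for p h h'
  proof -
    have "p (q h h') \<le> M p" using M(2)[OF p, of "q h h'"] h unfolding B_def by blast
    moreover have "p (q h h') = p (d h - d h') / (\<bar>h\<bar> powr \<gamma> + \<bar>h'\<bar> powr \<gamma>)"
      unfolding q_def seminorm_smul[OF p] norm_of_real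
      using pos[OF h(1), of h'] by (simp add: divide_simps)
    ultimately show ?thesis
      using pos[OF h(1), of h'] by (simp add: pos_divide_le_eq mult.commute)
  qed
  show ?thesis
    unfolding has_partial_deriv_def d_def[symmetric]
    by (rule locally_complete_tendsto_at_0[where M = M, OF assms(1) _ assms(4) r(1)]) (rule M(1) *; assumption)+
qed

text \<open>Existence and commutation with functionals alternate: once functionals commute with the
  derivative for a word, its partial derivatives exist by \<open>weak_has_partial_deriv\<close>, and
  existence gives commutation for the word longer by one.\<close>

lemma weak_iterated_Holder:
  fixes f :: "real^'d::finite \<Rightarrow> 'e"
  assumes "locally_complete smul P" "open \<Omega>" "0 < \<gamma>"
    and weak: "\<And>\<phi>. \<phi> \<in> G \<Longrightarrow> iterated_Holder (*) {norm} k \<gamma> \<Omega> (\<phi> \<circ> f)"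
  shows "iterated_Holder smul P k \<gamma> \<Omega> f"
proof -
  have weak_hol: "locally_Holder {norm} \<gamma> \<Omega> (foldr (partial_deriv (*)) is (\<phi> \<circ> f))"
    if "\<phi> \<in> G" "length is \<le> k" for \<phi> "is"
    using weak[OF that(1)] that(2) unfolding iterated_Holder_def by blast
  have weak_diff: "has_partial_deriv (*) i (foldr (partial_deriv (*)) is (\<phi> \<circ> f)) x"
    if "\<phi> \<in> G" "length is < k" "x \<in> \<Omega>" for \<phi> "is" i x
    using weak[OF that(1)] that(2,3) unfolding iterated_Holder_def by blast
  \<comment> \<open>Commutation is a premise here, so that the induction below can supply its own
    hypothesis.\<close>
  have step: "has_partial_deriv smul i (foldr (partial_deriv smul) is f) x"
    if "length is < k" "x \<in> \<Omega>"
      and eq: "\<And>\<phi> y. \<phi> \<in> G \<Longrightarrow> y \<in> \<Omega> \<Longrightarrow>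
        (\<phi> \<circ> foldr (partial_deriv smul) is f) y = foldr (partial_deriv (*)) is (\<phi> \<circ> f) y"
    for "is" i x
  proof (rule weak_has_partial_deriv[OF assms(1,2) that(2) assms(3)])
    fix \<phi> y assume \<phi>: "\<phi> \<in> G" and y: "y \<in> \<Omega>"
    show "has_partial_deriv (*) i (\<phi> \<circ> foldr (partial_deriv smul) is f) y"
      by (rule has_partial_deriv_cong[THEN iffD2, OF assms(2) y _ weak_diff[OF \<phi> that(1) y]])
         (rule eq[OF \<phi>])
  next
    fix \<phi> assume \<phi>: "\<phi> \<in> G"
    have "locally_Holder {norm} \<gamma> \<Omega> (partial_deriv (*) i (foldr (partial_deriv (*)) is (\<phi> \<circ> f)))"
      using weak_hol[OF \<phi>, of "i # is"] that(1) by simp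
    moreover have "partial_deriv (*) i (foldr (partial_deriv (*)) is (\<phi> \<circ> f)) y
        = partial_deriv (*) i (\<phi> \<circ> foldr (partial_deriv smul) is f) y" if "y \<in> \<Omega>" for y
      by (rule partial_deriv_cong[OF assms(2) that]) (rule eq[OF \<phi>, symmetric])
    ultimately show "locally_Holder {norm} \<gamma> \<Omega> (partial_deriv (*) i (\<phi> \<circ> foldr (partial_deriv smul) is f))"
      by (rule locally_Holder_cong)
  qed
  have eq: "(\<phi> \<circ> foldr (partial_deriv smul) is f) x = foldr (partial_deriv (*)) is (\<phi> \<circ> f) x"
    if "length is \<le> k" "\<phi> \<in> G" "x \<in> \<Omega>" for \<phi> "is" x
    using that
  proof (induction "is" arbitrary: \<phi> x)
    case (Cons i "is")
    have IH: "(\<phi> \<circ> foldr (partial_deriv smul) is f) y = foldr (partial_deriv (*)) is (\<phi> \<circ> f) y"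
      if "\<phi> \<in> G" "y \<in> \<Omega>" for \<phi> y
      by (rule Cons.IH[OF _ that]) (use Cons.prems(1) in simp)
    have "has_partial_deriv smul i (foldr (partial_deriv smul) is f) x"
      using Cons.prems IH by (intro step) auto
    then have "\<phi> (partial_deriv smul i (foldr (partial_deriv smul) is f) x)
        = partial_deriv (*) i (\<phi> \<circ> foldr (partial_deriv smul) is f) x"
      by (rule partial_deriv_functional[OF Cons.prems(2), symmetric])
    also have "\<dots> = partial_deriv (*) i (foldr (partial_deriv (*)) is (\<phi> \<circ> f)) x"
      by (rule partial_deriv_cong[OF assms(2) Cons.prems(3)]) (rule IH[OF Cons.prems(2)])
    finally show ?case by (simp add: o_def)
  qed simp
  have "locally_Holder P \<gamma> \<Omega> (foldr (partial_deriv smul) is f)" if "length is \<le> k" for "is"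
  proof (rule weak_locally_Holder)
    fix \<phi> assume \<phi>: "\<phi> \<in> G"
    show "locally_Holder {norm} \<gamma> \<Omega> (\<phi> \<circ> foldr (partial_deriv smul) is f)"
      using weak_hol[OF \<phi> that] by (rule locally_Holder_cong) (simp only: eq[OF that \<phi>])
  qed
  moreover have "has_partial_deriv smul i (foldr (partial_deriv smul) is f) x"
    if "length is < k" "x \<in> \<Omega>" for "is" i x
    using that eq by (intro step) auto
  ultimately show ?thesis by (simp add: iterated_Holder_def)
qed

end

theorem corollary5p3p5:
  fixes smul :: "'k::real_normed_field \<Rightarrow> 'e::{ab_group_add,t2_space} \<Rightarrow> 'e"
    and P :: "('e \<Rightarrow> real) set"
    and G :: "('e \<Rightarrow> 'k) set"
    and \<Omega> :: "(real^'d::{finite,linorder}) set"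
    and k :: nat
    and \<gamma> :: real
  assumes "lcHs smul P"
    and "locally_complete smul P"
    and "dual_subspace smul G"
    and "determines_boundedness P G"
    and "open \<Omega>"
    and "0 < \<gamma>" and "\<gamma> \<le> 1"
  shows "(\<forall>f :: (real, 'd) vec \<Rightarrow> 'e.
            (\<forall>e'\<in>G. e' \<circ> f \<in> C_loc_space (*) {norm} k \<gamma> \<Omega>) \<longrightarrow> f \<in> C_loc_space smul P k \<gamma> \<Omega>)
       \<and> (\<forall>f :: (real, 'd) vec \<Rightarrow> 'e.
            (\<forall>e'\<in>G. e' \<circ> f \<in> C_space (*) (k + 1) \<Omega>) \<longrightarrow> f \<in> C_loc_space smul P k 1 \<Omega>)"
proof -
  interpret boundedness_determining smul P G
    using assms(1,3,4) by unfold_locales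
  have "f \<in> C_loc_space smul P k \<gamma> \<Omega>"
    if "\<And>e'. e' \<in> G \<Longrightarrow> e' \<circ> f \<in> C_loc_space (*) {norm} k \<gamma> \<Omega>" for f :: "(real, 'd) vec \<Rightarrow> 'e"
    using C_loc_space_imp_iterated_Holder[OF assms(5,7) that]
    by (intro iterated_Holder_imp_C_loc_space weak_iterated_Holder assms(2,5,6))
  \<comment> \<open>Here the exponent is \<open>1\<close>: scalar derivatives up to order
    \<open>k\<close> are locally Lipschitz, as one more continuous derivative exists.\<close>
  moreover have "f \<in> C_loc_space smul P k 1 \<Omega>"
    if "\<And>e'. e' \<in> G \<Longrightarrow> e' \<circ> f \<in> C_space (*) (k + 1) \<Omega>" for f :: "(real, 'd) vec \<Rightarrow> 'e"
    using C_space_imp_iterated_Holder[OF assms(5) order_refl that]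
    by (intro iterated_Holder_imp_C_loc_space weak_iterated_Holder assms(2,5) zero_less_one)
  ultimately show ?thesis by blast
qed

end
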